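(* Let $M$ be a planar map whose underlying graph contains a subdivision of $K_4$ (as a subgraph). Then $\dim(\mathbf{P}_{VF}(M)) > 3$.
   Context: A planar map $M=(G,D)$ consists of a finite planar multigraph $G$ together with a plane drawing $D$ of $G$; it determines the set $V$ of vertices, the set $E$ of edges, the set $F$ of faces and the incidence relations among them. The vertex-edge-face poset $\mathbf{P}_{VEF}(M)$ is the poset on $V\cup E\cup F$ ordered by inclusion/incidence (a vertex is below each edge of which it is an endpoint and below each face on whose boundary it lies; an edge is below each face on whose boundary it lies). The vertex-face poset $\mathbf{P}_{VF}(M)$ is the subposet of $\mathbf{P}_{VEF}(M)$ induced by $V\cup F$. The dimension $\dim(\mathbf{P})$ of a finite poset $\mathbf{P}$ is the minimum number $t$ of linear orders on its ground set whose intersection is the order of $\mathbf{P}$. *)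

theory Defs
  imports "HOL-Analysis.Analysis" "HOL-Library.Extended_Nat"
begin

section \<open>Finite multigraphs and subdivisions\<close>

text \<open>Undirected multigraphs: edges are abstract objects, so parallel edges are allowed; an edge
  with a single end is a loop.\<close>

record ('v, 'e) multigraph =
  vertices :: "'v set"
  edges :: "'e set"
  ends :: "'e \<Rightarrow> 'v set"

definition multigraph :: "('v, 'e) multigraph \<Rightarrow> bool" where
  "multigraph G \<longleftrightarrow>
     (\<forall>e \<in> edges G. ends G e \<subseteq> vertices G \<and> (card (ends G e) = 1 \<or> card (ends G e) = 2))"

definition finite_multigraph :: "('v, 'e) multigraph \<Rightarrow> bool" where
  "finite_multigraph G \<longleftrightarrow> multigraph G \<and> finite (vertices G) \<and> finite (edges G)"

definition subgraph :: "('v, 'e) multigraph \<Rightarrow> ('v, 'e) multigraph \<Rightarrow> bool" where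
  "subgraph H G \<longleftrightarrow> multigraph H \<and> vertices H \<subseteq> vertices G \<and> edges H \<subseteq> edges G \<and>
     (\<forall>e \<in> edges H. ends H e = ends G e)"

definition complete_graph :: "nat \<Rightarrow> (nat, nat set) multigraph" where
  "complete_graph n =
     \<lparr>vertices = {..<n}, edges = {e. e \<subseteq> {..<n} \<and> card e = 2}, ends = (\<lambda>e. e)\<rparr>"

text \<open>A path is given by its list of vertices and its list of edges and has at least one edge.
  The conditions allow the first and the last vertex to coincide, in which case the path is a
  cycle; this case is only used for subdividing loops.\<close>

definition graph_path :: "('v, 'e) multigraph \<Rightarrow> 'v list \<Rightarrow> 'e list \<Rightarrow> bool" where
  "graph_path G xs es \<longleftrightarrow>
     es \<noteq> [] \<and> length xs = Suc (length es) \<and> set xs \<subseteq> vertices G \<and> set es \<subseteq> edges G \<and>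
     (\<forall>i < length es. ends G (es ! i) = {xs ! i, xs ! Suc i}) \<and>
     distinct (tl xs) \<and> distinct (butlast xs) \<and> distinct es"

definition inner_vertices :: "'v list \<Rightarrow> 'v set" where
  "inner_vertices xs = set (butlast (tl xs))"

text \<open>\<open>H\<close> arises from \<open>K\<close> by replacing every edge \<open>e\<close> by a path (\<open>xs e\<close>, \<open>es e\<close>) between its ends,
  the paths being disjoint except at their ends; \<open>f\<close> gives the branch vertices.\<close>

definition subdivision :: "('a, 'b) multigraph \<Rightarrow> ('v, 'e) multigraph \<Rightarrow> bool" where
  "subdivision K H \<longleftrightarrow>
     (\<exists>(f :: 'a \<Rightarrow> 'v) (xs :: 'b \<Rightarrow> 'v list) (es :: 'b \<Rightarrow> 'e list).
        inj_on f (vertices K) \<and>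
        (\<forall>e \<in> edges K. graph_path H (xs e) (es e) \<and>
            {hd (xs e), last (xs e)} = f ` ends K e \<and>
            inner_vertices (xs e) \<inter> f ` vertices K = {}) \<and>
        (\<forall>e \<in> edges K. \<forall>e' \<in> edges K. e \<noteq> e' \<longrightarrow>
            inner_vertices (xs e) \<inter> inner_vertices (xs e') = {} \<and>
            set (es e) \<inter> set (es e') = {}) \<and>
        vertices H = f ` vertices K \<union> (\<Union>e \<in> edges K. set (xs e)) \<and>
        edges H = (\<Union>e \<in> edges K. set (es e)))"

definition contains_subdivision_of ::
    "('v, 'e) multigraph \<Rightarrow> ('a, 'b) multigraph \<Rightarrow> bool" where
  "contains_subdivision_of G K \<longleftrightarrow> (\<exists>H. subgraph H G \<and> subdivision K H)"


section \<open>Planar maps\<close>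

record ('v, 'e) planar_map =
  graph :: "('v, 'e) multigraph"
  point :: "'v \<Rightarrow> complex"
  curve :: "'e \<Rightarrow> real \<Rightarrow> complex"

text \<open>The plane is the type of complex numbers. A non-loop is drawn as an arc, because
  \<^const>\<open>simple_path\<close> with distinct end points is an \<^const>\<open>arc\<close>; a loop is drawn as a simple closed
  curve. Curves meet vertices only in their own ends, and each other only in vertices.\<close>

definition planar_map :: "('v, 'e) planar_map \<Rightarrow> bool" where
  "planar_map M \<longleftrightarrow>
     finite_multigraph (graph M) \<and>
     inj_on (point M) (vertices (graph M)) \<and>
     (\<forall>e \<in> edges (graph M).
        simple_path (curve M e) \<and>
        {pathstart (curve M e), pathfinish (curve M e)} = point M ` ends (graph M) e \<and>
        path_image (curve M e) \<inter> point M ` vertices (graph M) = point M ` ends (graph M) e) \<and>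
     (\<forall>e \<in> edges (graph M). \<forall>e' \<in> edges (graph M). e \<noteq> e' \<longrightarrow>
        path_image (curve M e) \<inter> path_image (curve M e') \<subseteq> point M ` vertices (graph M))"

definition drawing :: "('v, 'e) planar_map \<Rightarrow> complex set" where
  "drawing M =
     point M ` vertices (graph M) \<union> (\<Union>e \<in> edges (graph M). path_image (curve M e))"

definition faces :: "('v, 'e) planar_map \<Rightarrow> complex set set" where
  "faces M = components (- drawing M)"


section \<open>Posets and their dimension\<close>

type_synonym 'a poset = "'a set \<times> 'a rel"

definition subposet :: "'a poset \<Rightarrow> 'a set \<Rightarrow> 'a poset" where
  "subposet P A = (fst P \<inter> A, snd P \<inter> A \<times> A)"

definition realizer :: "'a poset \<Rightarrow> 'a rel set \<Rightarrow> bool" where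
  "realizer P R \<longleftrightarrow> R \<noteq> {} \<and> (\<forall>L \<in> R. linear_order_on (fst P) L) \<and> \<Inter>R = snd P"

text \<open>A finite poset has a finite realizer, so for finite posets this infimum is the minimum
  size of a realizer.\<close>

definition poset_dim :: "'a poset \<Rightarrow> enat" where
  "poset_dim P = (INF R \<in> {R. finite R \<and> realizer P R}. enat (card R))"


section \<open>The posets of a planar map\<close>

datatype ('v, 'e) cell = Vertex 'v | Edge 'e | Face "complex set"

definition vef_poset :: "('v, 'e) planar_map \<Rightarrow> ('v, 'e) cell poset" where
  "vef_poset M =
     (let C = Vertex ` vertices (graph M) \<union> Edge ` edges (graph M) \<union> Face ` faces M
      in (C, Id_on C \<union>
         {(Vertex v, Edge e) | v e. e \<in> edges (graph M) \<and> v \<in> ends (graph M) e} \<union>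
         {(Vertex v, Face F) | v F.
            v \<in> vertices (graph M) \<and> F \<in> faces M \<and> point M v \<in> frontier F} \<union>
         {(Edge e, Face F) | e F.
            e \<in> edges (graph M) \<and> F \<in> faces M \<and> path_image (curve M e) \<subseteq> frontier F}))"

definition vf_poset :: "('v, 'e) planar_map \<Rightarrow> ('v, 'e) cell poset" where
  "vf_poset M = subposet (vef_poset M) (Vertex ` vertices (graph M) \<union> Face ` faces M)"

lemma partial_order_vef_poset:
  assumes "planar_map M"
  shows "partial_order_on (fst (vef_poset M)) (snd (vef_poset M))"
proof -
  have ends_edge: "ends (graph M) e \<subseteq> vertices (graph M)"
    "point M ` ends (graph M) e \<subseteq> path_image (curve M e)" if "e \<in> edges (graph M)" for e
  proof -
    show "ends (graph M) e \<subseteq> vertices (graph M)"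
      using assms that by (simp add: planar_map_def finite_multigraph_def multigraph_def)
    have "path_image (curve M e) \<inter> point M ` vertices (graph M) = point M ` ends (graph M) e"
      using assms that by (simp add: planar_map_def)
    then show "point M ` ends (graph M) e \<subseteq> path_image (curve M e)" by blast
  qed
  define C where "C = fst (vef_poset M)"
  define r where "r = snd (vef_poset M)"
  have C: "Vertex v \<in> C \<longleftrightarrow> v \<in> vertices (graph M)" "Edge e \<in> C \<longleftrightarrow> e \<in> edges (graph M)"
    "Face F \<in> C \<longleftrightarrow> F \<in> faces M" for v e F
    by (auto simp: C_def vef_poset_def Let_def)
  have r: "(x, y) \<in> r \<longleftrightarrow> x \<in> C \<and> y \<in> C \<and> (x = y \<or>
      (case (x, y) of
        (Vertex v, Edge e) \<Rightarrow> v \<in> ends (graph M) e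
      | (Vertex v, Face F) \<Rightarrow> point M v \<in> frontier F
      | (Edge e, Face F) \<Rightarrow> path_image (curve M e) \<subseteq> frontier F
      | _ \<Rightarrow> False))" for x y
    by (cases x; cases y; simp add: r_def C_def vef_poset_def Let_def image_iff Id_on_iff)
      (use ends_edge(1) in blast)+
  have "r \<subseteq> C \<times> C" "refl_on C r"
    by (auto simp: r refl_on_def)
  moreover have "antisym r"
    by (rule antisymI) (auto simp: r split: cell.splits)
  moreover have "trans r"
  proof (rule transI)
    fix x y z assume "(x, y) \<in> r" "(y, z) \<in> r"
    then show "(x, z) \<in> r"
      using ends_edge(2) by (cases x; cases y; cases z; simp add: r C) blast+
  qed
  ultimately show ?thesis
    by (simp add: partial_order_on_def preorder_on_def C_def r_def)
qed

end

theory Submission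
  imports Defs
begin

text \<open>
  Three linear orders assign to distinct vertices \<open>v\<close>, \<open>w\<close> the set of those \<open>i\<close> for which \<open>v\<close> lies
  above \<open>w\<close> in the \<open>i\<close>-th order. It is a nonempty proper subset of three indices, that is, a corner of
  a hexagon, and exchanging \<open>v\<close> and \<open>w\<close> gives the antipodal corner; think of it as the direction from
  \<open>w\<close> to \<open>v\<close>. The theorem is then a discrete form of the topological Radon theorem for maps of the
  boundary of a tetrahedron into the plane.

  Let \<open>C\<close> be the cycle of the subdivision opposite to the branch vertex \<open>x\<close>, and let \<open>\<Phi>\<close> be the side
  of \<open>C\<close> that does not contain \<open>x\<close>. Every face inside \<open>\<Phi>\<close> lies below \<open>x\<close> in one of the three orders, so
  the closure of \<open>\<Phi>\<close> is covered by three closed sets without a common point. This yields a map from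
  the closure of \<open>\<Phi>\<close> to the punctured plane, which has a continuous logarithm; hence the direction seen
  from \<open>x\<close> makes no net turn along \<open>C\<close>. For edges \<open>uw\<close> and \<open>yz\<close> on opposite paths of the subdivision, the
  four directions between \<open>u\<close>, \<open>w\<close> and \<open>y\<close>, \<open>z\<close> lie in an open half-plane, so there is no net turn
  around a product of opposite paths either. But a direction and its antipode differ by half a turn,
  and counting half turns over the four cycles and the three pairs of opposite paths gives an odd
  number.
\<close>

section \<open>Faces of a planar map near its edges\<close>

text \<open>The inverse of an arc is continuous and injective, so an open piece of the plane inside
  the image would embed into the line, against invariance of dimension.\<close>

lemma interior_path_image_arc:
  fixes g :: "real \<Rightarrow> complex"
  assumes "arc g"
  shows "interior (path_image g) = {}"
proof (rule ccontr)
  assume ne: "interior (path_image g) \<noteq> {}"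
  obtain h where h: "homeomorphism {0..1} (path_image g) g h"
    using homeomorphism_arc[OF assms] .
  have "continuous_on (interior (path_image g)) h"
    using h interior_subset by (auto simp: homeomorphism_def intro: continuous_on_subset)
  moreover have "inj_on h (interior (path_image g))"
    using h interior_subset[of "path_image g"]
    by (intro inj_on_inverseI[of _ g]) (auto simp: homeomorphism_def)
  ultimately have "DIM(complex) \<le> DIM(real)"
    using ne open_interior invariance_of_dimension by blast
  then show False by simp
qed

text \<open>A closed curve is not an arc, but its two halves are, and closed sets with empty
  interior have a union with empty interior.\<close>

lemma interior_path_image_simple_path:
  fixes g :: "real \<Rightarrow> complex"
  assumes "simple_path g"
  shows "interior (path_image g) = {}"
proof -
  have "arc (subpath 0 (1/2) g)" "arc (subpath (1/2) 1 g)"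
    using assms by (auto intro!: arc_simple_path_subpath_interior)
  moreover have "path_image g = path_image (subpath 0 (1/2) g) \<union> path_image (subpath (1/2) 1 g)"
    by (metis join_subpaths_middle path_image_join pathfinish_subpath pathstart_subpath)
  moreover have "closed (path_image (subpath 0 (1/2) g))"
    using calculation(1) by (simp add: arc_imp_path closed_path_image)
  ultimately show ?thesis
    using interior_path_image_arc by (metis interior_closed_Un_empty_interior)
qed

text \<open>If the frontier missed \<open>g r\<close>, it would miss a whole stretch of
  \<open>g\<close> around it. Removing this stretch leaves the initial piece \<open>S\<close> and
  the remainder \<open>T\<close>. Neither separates a point of \<open>F\<close> from
  \<open>g r\<close>, and they meet in one point, so by Janiszewski's theorem their union does not
  separate either. But the union contains the frontier of \<open>F\<close>, and \<open>g r\<close>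
  lies outside \<open>F\<close>.\<close>

lemma frontier_propagates_along_path:
  fixes g :: "real \<Rightarrow> complex"
  assumes g: "simple_path g" and X: "closed X" "path_image g \<inter> X = {pathstart g, pathfinish g}"
    and F: "F \<inter> (X \<union> path_image g) = {}" "frontier F \<subseteq> X \<union> path_image g"
    and s: "0 < s" "s < r" "r < 1" "g s \<in> frontier F"
  shows "g r \<in> frontier F"
proof (rule ccontr)
  assume nr: "g r \<notin> frontier F"
  have inj: "\<lbrakk>x \<in> {0..1}; y \<in> {0..1}; g x = g y\<rbrakk> \<Longrightarrow> x = y \<or> x = 0 \<and> y = 1 \<or> x = 1 \<and> y = 0" for x y
    using g by (auto simp: simple_path_def loop_free_def)
  have cont: "continuous_on {0..1} g"
    using g by (simp add: simple_path_def path_def)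
  have img: "g t \<in> path_image g" if "t \<in> {0..1}" for t
    using that by (auto simp: path_image_def)
  have notX: "g t \<notin> X" if "0 < t" "t < 1" for t
  proof
    assume "g t \<in> X"
    then have "g t = g 0 \<or> g t = g 1"
      using X(2) img[of t] that by (auto simp: pathstart_def pathfinish_def)
    then show False using inj[of t 0] inj[of t 1] that by auto
  qed
  have "closed ({0..1} \<inter> g -` frontier F)"
    by (rule continuous_closed_preimage[OF cont]) auto
  then have "open (- ({0..1} \<inter> g -` frontier F) \<inter> {s<..<1})"
    by (intro open_Int open_Compl) auto
  moreover have "r \<in> - ({0..1} \<inter> g -` frontier F) \<inter> {s<..<1}" using s nr by auto
  ultimately obtain d where d: "d > 0" "cball r d \<subseteq> - ({0..1} \<inter> g -` frontier F) \<inter> {s<..<1}"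
    using open_contains_cball by metis
  have rd: "r - d \<in> cball r d" "r + d \<in> cball r d" using d(1) by (auto simp: dist_real_def)
  have "cball r d \<subseteq> {s<..<1}" using d(2) by blast
  then have rs: "s < r - d" "r + d < 1" using rd by (meson greaterThanLessThan_iff subsetD)+
  have gap: "g t \<notin> frontier F" if "t \<in> {r-d..r+d}" for t
  proof -
    have "t \<in> cball r d" using that by (auto simp: dist_real_def)
    then have "t \<notin> {0..1} \<inter> g -` frontier F" "t \<in> {s<..<1}" using d(2) by blast+
    then show ?thesis using s by auto
  qed
  define S where "S = g ` {0..r-d}"
  define T where "T = X \<union> g ` {r+d..1}"
  have subS: "S = path_image (subpath 0 (r-d) g)" and arcS: "arc (subpath 0 (r-d) g)"
    using rs s d g by (auto simp: S_def path_image_subpath intro!: arc_simple_path_subpath_interior)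
  have "compact S" using subS arcS by (simp add: compact_arc_image)
  have "closed T"
    unfolding T_def
    by (intro closed_Un X compact_imp_closed compact_continuous_image continuous_on_subset[OF cont])
      (use rs s d in auto)
  \<comment> \<open>Beyond its start, \<open>S\<close> avoids \<open>X\<close>; it can meet the
    final piece only if \<open>g\<close> closes up, that is, in \<open>g 0 = g 1\<close>.\<close>
  have "S \<inter> T = {g 0}"
  proof
    show "S \<inter> T \<subseteq> {g 0}"
    proof
      fix z assume "z \<in> S \<inter> T"
      then obtain t where t: "t \<in> {0..r-d}" "z = g t" and zT: "g t \<in> T" by (auto simp: S_def)
      show "z \<in> {g 0}"
      proof (cases "t = 0")
        case False
        then have "g t \<notin> X" using t rs d by (intro notX) auto
        then obtain t' where "t' \<in> {r+d..1}" "g t = g t'" using zT by (auto simp: T_def)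
        then have "t = t' \<or> t = 0 \<and> t' = 1 \<or> t = 1 \<and> t' = 0"
          using t rs(2) d(1) s by (intro inj) auto
        then show ?thesis using \<open>t' \<in> {r+d..1}\<close> t(1) False rs d(1) by auto
      qed (use t in auto)
    qed
    have "g 0 \<in> X" using X(2) by (auto simp: pathstart_def)
    then show "{g 0} \<subseteq> S \<inter> T" using rs s by (auto simp: S_def T_def)
  qed
  then have "connected (S \<inter> T)" by simp
  have pT: "g t \<notin> T" if "t \<in> {s..r}" for t
  proof
    assume "g t \<in> T"
    moreover have "g t \<notin> X" using that s by (intro notX) auto
    ultimately obtain t' where "t' \<in> {r+d..1}" "g t = g t'" by (auto simp: T_def)
    then have "t = t' \<or> t = 0 \<and> t' = 1 \<or> t = 1 \<and> t' = 0"
      using that rs(2) d(1) s by (intro inj) auto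
    then show False using \<open>t' \<in> {r+d..1}\<close> that d(1) s by auto
  qed
  then have "g s \<in> - T" using s by auto
  then obtain \<delta> where \<delta>: "\<delta> > 0" "ball (g s) \<delta> \<subseteq> - T"
    using \<open>closed T\<close> by (meson open_Compl openE)
  have "g s \<in> closure F" using s(4) by (simp add: frontier_def)
  then obtain a where a: "a \<in> F" "dist a (g s) < \<delta>"
    using \<delta>(1) closure_approachable by blast
  \<comment> \<open>A small disc around \<open>g s\<close> contains a point \<open>a\<close> of
    \<open>F\<close>, and it can be left along \<open>g\<close> from \<open>s\<close> to
    \<open>r\<close>, all without touching \<open>T\<close>.\<close>
  have ccT: "connected_component (- T) a (g r)"
    unfolding connected_component_def
  proof (intro exI conjI)
    have "connected (g ` {s..r})"
      by (intro connected_continuous_image continuous_on_subset[OF cont]) (use s in auto)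
    moreover have "g s \<in> ball (g s) \<delta> \<inter> g ` {s..r}" using \<delta>(1) s by auto
    ultimately show "connected (ball (g s) \<delta> \<union> g ` {s..r})"
      by (intro connected_Un connected_ball) blast+
    show "ball (g s) \<delta> \<union> g ` {s..r} \<subseteq> - T" using \<delta>(2) pT by auto
    show "a \<in> ball (g s) \<delta> \<union> g ` {s..r}" using a(2) by (simp add: dist_commute)
    show "g r \<in> ball (g s) \<delta> \<union> g ` {s..r}" using s by auto
  qed
  have SD: "S \<subseteq> path_image g" using rs d s by (auto simp: S_def path_image_def)
  have "connected (- S)" using connected_arc_complement[OF arcS] by (simp add: subS)
  moreover have "a \<in> - S" using a(1) F(1) SD by auto
  moreover have "g r \<in> - S"
  proof
    assume "g r \<in> S"
    then obtain t where "t \<in> {0..r-d}" "g r = g t" by (auto simp: S_def)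
    then have "r = t \<or> r = 0 \<and> t = 1 \<or> r = 1 \<and> t = 0"
      using rs(2) d(1) s by (intro inj) auto
    then show False using \<open>t \<in> {0..r-d}\<close> d(1) s by auto
  qed
  ultimately have ccS: "connected_component (- S) a (g r)"
    using connected_component_def by blast
  obtain N where N: "connected N" "N \<subseteq> - (S \<union> T)" "a \<in> N" "g r \<in> N"
    using Janiszewski[OF \<open>compact S\<close> \<open>closed T\<close> \<open>connected (S \<inter> T)\<close> ccS ccT]
    unfolding connected_component_def by blast
  have "g r \<notin> F" using F(1) img[of r] s by auto
  then have "N \<inter> frontier F \<noteq> {}"
    using N a(1) by (intro connected_Int_frontier) auto
  moreover have "frontier F \<subseteq> S \<union> T"
  proof
    fix z assume z: "z \<in> frontier F"
    then consider "z \<in> X" | t where "t \<in> {0..1}" "z = g t"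
      using F(2) by (auto simp: path_image_def)
    then show "z \<in> S \<union> T"
    proof cases
      case (2 t)
      then have "t \<notin> {r-d..r+d}" using z gap by auto
      then show ?thesis using 2 by (auto simp: S_def T_def)
    qed (simp add: T_def)
  qed
  ultimately show False using N(2) by auto
qed

text \<open>Propagation runs forwards only. Parameters before \<open>s\<close> are reached on the
  reversed path, and the two ends by taking the closure.\<close>

lemma path_image_subset_frontier:
  fixes g :: "real \<Rightarrow> complex"
  assumes g: "simple_path g" and X: "closed X" "path_image g \<inter> X = {pathstart g, pathfinish g}"
    and F: "F \<inter> (X \<union> path_image g) = {}" "frontier F \<subseteq> X \<union> path_image g"
    and p: "p \<in> path_image g" "p \<notin> X" "p \<in> frontier F"
  shows "path_image g \<subseteq> frontier F"
proof -
  obtain s where s: "s \<in> {0..1}" "p = g s" using p by (auto simp: path_image_def)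
  have "s \<noteq> 0" "s \<noteq> 1" using p X(2) s by (auto simp: pathstart_def pathfinish_def)
  then have s01: "0 < s" "s < 1" using s by auto
  have in01: "g r \<in> frontier F" if r: "0 < r" "r < 1" for r
  proof (rule linorder_cases[of s r])
    assume "s < r"
    then show ?thesis
      using frontier_propagates_along_path[OF g X F, of s r] s01 r p s by auto
  next
    assume "r < s"
    have "reversepath g (1 - r) \<in> frontier F"
    proof (rule frontier_propagates_along_path[of "reversepath g" X F "1 - s"])
      show "simple_path (reversepath g)" using g by (simp add: simple_path_reversepath)
      show "path_image (reversepath g) \<inter> X = {pathstart (reversepath g), pathfinish (reversepath g)}"
        using X(2) by auto
      show "F \<inter> (X \<union> path_image (reversepath g)) = {}" "frontier F \<subseteq> X \<union> path_image (reversepath g)"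
        using F by simp_all
      show "reversepath g (1 - s) \<in> frontier F" using p s by (simp add: reversepath_def)
    qed (use X r s01 \<open>r < s\<close> in auto)
    then show ?thesis by (simp add: reversepath_def)
  qed (use p s in auto)
  have "g ` closure {0<..<1} \<subseteq> frontier F"
  proof (rule image_closure_subset)
    show "continuous_on (closure {0<..<1}) g" using g by (simp add: simple_path_def path_def)
  qed (use in01 in auto)
  then show ?thesis by (simp add: path_image_def)
qed

section \<open>Finite drawings: how faces behave near edges and vertices\<close>

locale plane_map =
  fixes M :: "('v, 'e) planar_map"
  assumes planar: "planar_map M"
begin

abbreviation "V \<equiv> vertices (graph M)"
abbreviation "E \<equiv> edges (graph M)"

lemma curve_facts:
  assumes "e \<in> E"
  shows "simple_path (curve M e)"
    "{pathstart (curve M e), pathfinish (curve M e)} = point M ` ends (graph M) e"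
    "path_image (curve M e) \<inter> point M ` V = point M ` ends (graph M) e"
    "ends (graph M) e \<subseteq> V"
    "\<And>e'. e' \<in> E \<Longrightarrow> e \<noteq> e' \<Longrightarrow> path_image (curve M e) \<inter> path_image (curve M e') \<subseteq> point M ` V"
  using planar assms by (auto simp: planar_map_def finite_multigraph_def multigraph_def)

lemma finite_VE: "finite V" "finite E" and inj_point: "inj_on (point M) V"
  using planar by (auto simp: planar_map_def finite_multigraph_def)

lemma closed_curve_image: "e \<in> E \<Longrightarrow> closed (path_image (curve M e))"
  using curve_facts(1) by (simp add: closed_path_image simple_path_def)

lemma compact_drawing: "compact (drawing M)"
  unfolding drawing_def using finite_VE curve_facts(1)
  by (intro compact_Un compact_UN) (auto simp: compact_simple_path_image finite_imp_compact)

lemma interior_drawing: "interior (drawing M) = {}"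
proof -
  have "closed B \<and> interior B = {}" if "finite K" "B = (\<Union>e\<in>K. path_image (curve M e))" "K \<subseteq> E" for K B
    using that
  proof (induction K arbitrary: B rule: finite_induct)
    case (insert e K)
    then have IH: "closed (\<Union>e\<in>K. path_image (curve M e))" "interior (\<Union>e\<in>K. path_image (curve M e)) = {}"
      by auto
    have "interior (path_image (curve M e) \<union> (\<Union>e\<in>K. path_image (curve M e))) = {}"
      using insert.prems IH
      by (subst interior_closed_Un_empty_interior)
        (auto simp: closed_curve_image interior_path_image_simple_path curve_facts(1))
    then show ?case using insert.prems IH closed_curve_image by auto
  qed auto
  then have "interior (\<Union>e\<in>E. path_image (curve M e)) = {}"
    using finite_VE by blast
  moreover have "closed (point M ` V)" "interior (point M ` V) = {}"
    using finite_VE by (auto simp: finite_imp_closed empty_interior_finite)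
  ultimately show ?thesis
    by (simp add: drawing_def interior_closed_Un_empty_interior)
qed

lemma face_facts:
  assumes "F \<in> faces M"
  shows "open F" "connected F" "F \<noteq> {}" "F \<inter> drawing M = {}" "frontier F \<subseteq> drawing M"
proof -
  have cl: "closed (drawing M)" using compact_drawing compact_imp_closed by blast
  show "open F"
    using assms cl open_components open_Compl unfolding faces_def by blast
  show "connected F" "F \<noteq> {}" "F \<inter> drawing M = {}"
    using assms unfolding faces_def
    by (auto simp: in_components_connected in_components_nonempty dest: in_components_subset)
  show "frontier F \<subseteq> drawing M"
    using assms cl frontier_of_components_closed_complement unfolding faces_def by blast
qed

text \<open>Taking for \<open>X\<close> everything drawn besides \<open>e\<close> reduces this to a
  single curve: the rest of the drawing meets it in its ends only.\<close>

lemma edge_subset_frontier_face: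
  assumes e: "e \<in> E" and F: "F \<in> faces M" and p: "p \<in> path_image (curve M e)" "p \<notin> point M ` V" "p \<in> frontier F"
  shows "path_image (curve M e) \<subseteq> frontier F"
proof -
  define X where "X = point M ` V \<union> (\<Union>e'\<in>E - {e}. path_image (curve M e'))"
  have XD: "X \<union> path_image (curve M e) = drawing M"
    using e by (auto simp: X_def drawing_def)
  have capX: "path_image (curve M e) \<inter> X = path_image (curve M e) \<inter> point M ` V"
    using curve_facts(5)[OF e] by (fastforce simp: X_def)
  show ?thesis
  proof (rule path_image_subset_frontier[of "curve M e" X F p])
    show "closed X"
      unfolding X_def using finite_VE closed_curve_image
      by (intro closed_Un closed_UN finite_imp_closed) auto
    show "path_image (curve M e) \<inter> X = {pathstart (curve M e), pathfinish (curve M e)}"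
      using capX curve_facts[OF e] by simp
    show "p \<notin> X" using capX p by blast
  qed (use curve_facts(1)[OF e] p XD face_facts[OF F] in auto)
qed

text \<open>The disc avoids all vertices other than \<open>p\<close> and all curves not through
  \<open>p\<close>. A face entering it without \<open>p\<close> in its closure has a frontier point
  there, which must be an inner point of an edge through \<open>p\<close>; then the whole edge,
  \<open>p\<close> included, belongs to the frontier.\<close>

lemma faces_near_point:
  obtains \<epsilon> where "\<epsilon> > 0" "\<And>F. F \<in> faces M \<Longrightarrow> F \<inter> ball p \<epsilon> \<noteq> {} \<Longrightarrow> p \<in> closure F"
proof -
  define B where "B = point M ` (V - {v. point M v = p}) \<union>
      (\<Union>e\<in>{e\<in>E. p \<notin> path_image (curve M e)}. path_image (curve M e))"
  have "closed B"
    unfolding B_def using finite_VE closed_curve_image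
    by (intro closed_Un closed_UN finite_imp_closed) auto
  moreover have "p \<in> - B" by (auto simp: B_def)
  ultimately obtain \<epsilon> where \<epsilon>: "\<epsilon> > 0" "ball p \<epsilon> \<subseteq> - B"
    by (meson open_Compl openE)
  have "p \<in> closure F" if F: "F \<in> faces M" and FB: "F \<inter> ball p \<epsilon> \<noteq> {}" for F
  proof (rule ccontr)
    assume np: "p \<notin> closure F"
    then have "p \<notin> F" using closure_subset by blast
    then have "p \<in> ball p \<epsilon> - F" using \<epsilon>(1) by simp
    then have "ball p \<epsilon> - F \<noteq> {}" by blast
    then obtain q where q: "q \<in> ball p \<epsilon>" "q \<in> frontier F"
      using connected_Int_frontier[of "ball p \<epsilon>" F] FB connected_ball by blast
    then have qD: "q \<in> drawing M" and "q \<notin> B" using face_facts(5)[OF F] \<epsilon>(2) by blast+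
    have "q \<noteq> p" using q(2) np by (auto simp: frontier_def)
    then have nV: "q \<notin> point M ` V" using \<open>q \<notin> B\<close> by (auto simp: B_def)
    then obtain e where e: "e \<in> E" "q \<in> path_image (curve M e)"
      using qD by (auto simp: drawing_def)
    then have "p \<in> path_image (curve M e)" using \<open>q \<notin> B\<close> by (auto simp: B_def)
    then have "p \<in> frontier F" using edge_subset_frontier_face[OF e(1) F e(2) nV q(2)] by auto
    then show False using np by (simp add: frontier_def)
  qed
  then show thesis using that \<epsilon> by blast
qed

text \<open>Arbitrary unions are allowed because a face that comes close to \<open>p\<close> already
  has \<open>p\<close> in its closure.\<close>

lemma closed_Union_closure_faces:
  assumes "\<F> \<subseteq> faces M"
  shows "closed (\<Union>F\<in>\<F>. closure F)"
  unfolding closed_limpt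
proof (intro allI impI)
  fix p assume p: "p islimpt (\<Union>F\<in>\<F>. closure F)"
  obtain \<epsilon> where \<epsilon>: "\<epsilon> > 0" "\<And>F. F \<in> faces M \<Longrightarrow> F \<inter> ball p \<epsilon> \<noteq> {} \<Longrightarrow> p \<in> closure F"
    using faces_near_point[of p] by blast
  obtain q F where q: "F \<in> \<F>" "q \<in> closure F" "dist q p < \<epsilon>"
    using p \<epsilon>(1) by (auto simp: islimpt_approachable)
  then have "F \<inter> ball p \<epsilon> \<noteq> {}"
    using open_Int_closure_eq_empty[of "ball p \<epsilon>" F] by (auto simp: dist_commute)
  then show "p \<in> (\<Union>F\<in>\<F>. closure F)" using \<epsilon>(2) q(1) assms by auto
qed

text \<open>The drawing has empty interior, so \<open>\<Phi>\<close> has points off it arbitrarily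
  close to \<open>p\<close>. The face of such a point cannot leave \<open>\<Phi>\<close> without
  meeting the drawing.\<close>

lemma closure_open_covered_by_faces:
  assumes \<Phi>: "open \<Phi>" "frontier \<Phi> \<subseteq> drawing M" and p: "p \<in> closure \<Phi>"
  obtains F where "F \<in> faces M" "F \<subseteq> \<Phi>" "p \<in> closure F"
proof -
  obtain \<epsilon> where \<epsilon>: "\<epsilon> > 0" "\<And>F. F \<in> faces M \<Longrightarrow> F \<inter> ball p \<epsilon> \<noteq> {} \<Longrightarrow> p \<in> closure F"
    using faces_near_point[of p] by blast
  have "\<Phi> \<inter> ball p \<epsilon> \<noteq> {}"
    using p \<epsilon>(1) by (metis IntI centre_in_ball empty_iff inf_commute open_Int_closure_eq_empty open_ball)
  moreover have "open (\<Phi> \<inter> ball p \<epsilon>)" using \<Phi> by blast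
  ultimately obtain q where q: "q \<in> \<Phi>" "q \<in> ball p \<epsilon>" "q \<notin> drawing M"
    using interior_drawing by (metis IntE equals0D interior_maximal subsetI subset_empty)
  define F where "F = connected_component_set (- drawing M) q"
  have F: "F \<in> faces M" "q \<in> F"
    using q by (auto simp: F_def faces_def componentsI)
  have "F \<subseteq> \<Phi>"
    using connected_Int_frontier[of F \<Phi>] face_facts[OF F(1)] F(2) q(1) \<Phi>(2) by blast
  then show thesis using that F \<epsilon>(2)[OF F(1)] q by blast
qed

end


section \<open>Logarithms on the sides of a Jordan curve\<close>

text \<open>The radius is a Lebesgue number of the cover of \<open>K\<close> by the sets
  \<open>U q\<close>, which avoid every member of the family not containing \<open>q\<close>. So a
  slight thickening brings together only indices that already occur together at a point of
  \<open>K\<close>.\<close>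

lemma closed_family_near_compact:
  fixes A :: "nat \<Rightarrow> complex set"
  assumes "compact K" and A: "\<And>i. i < n \<Longrightarrow> closed (A i)"
  shows "\<exists>\<epsilon>>0. \<forall>z\<in>K. \<exists>q\<in>K. \<forall>i<n. A i \<inter> ball z \<epsilon> \<noteq> {} \<longrightarrow> q \<in> A i"
proof -
  define U where "U = (\<lambda>q. - (\<Union>i\<in>{i. i < n \<and> q \<notin> A i}. A i))"
  have "open (U q)" for q
    unfolding U_def using A by (intro open_Compl closed_UN) auto
  moreover have "q \<in> U q" for q by (auto simp: U_def)
  ultimately obtain \<epsilon> where \<epsilon>: "\<epsilon> > 0" "\<And>z. z \<in> K \<Longrightarrow> \<exists>G\<in>U ` K. ball z \<epsilon> \<subseteq> G"
    using Heine_Borel_lemma[of K "U ` K"] \<open>compact K\<close> by (metis UN_I imageE subsetI)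
  have "\<exists>q\<in>K. \<forall>i<n. A i \<inter> ball z \<epsilon> \<noteq> {} \<longrightarrow> q \<in> A i" if "z \<in> K" for z
  proof -
    obtain q where q: "q \<in> K" "ball z \<epsilon> \<subseteq> U q" using \<epsilon>(2)[OF \<open>z \<in> K\<close>] by blast
    have "q \<in> A i" if i: "i < n" and ne: "A i \<inter> ball z \<epsilon> \<noteq> {}" for i
    proof (rule ccontr)
      assume "q \<notin> A i"
      then have "U q \<inter> A i = {}" using i unfolding U_def by blast
      then show False using ne q(2) by blast
    qed
    then show ?thesis using q(1) by blast
  qed
  then show ?thesis using \<epsilon>(1) by blast
qed

text \<open>Replaces a closed family by continuous weights without enlarging its overlaps: indices
  with positive weight at a point of \<open>K\<close> occur together at a point of the same
  \<open>K\<close>. Several compact sets are treated at once because later it matters in which of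
  them \<open>q\<close> lies.\<close>

lemma bump_functions_closed_family:
  fixes A :: "nat \<Rightarrow> complex set"
  assumes "finite \<K>" "\<And>K. K \<in> \<K> \<Longrightarrow> compact K" and A: "\<And>i. i < n \<Longrightarrow> closed (A i)"
  obtains \<epsilon> and f :: "nat \<Rightarrow> complex \<Rightarrow> real" where
    "\<epsilon> > 0" "\<forall>i. continuous_on UNIV (f i)" "\<forall>i z. f i z \<ge> 0"
    "\<forall>i. \<forall>z\<in>A i. f i z = \<epsilon>" "\<forall>i z. f i z > 0 \<longrightarrow> A i \<inter> ball z 1 \<noteq> {}"
    "\<forall>K\<in>\<K>. \<forall>z\<in>K. \<exists>q\<in>K. \<forall>i<n. f i z > 0 \<longrightarrow> q \<in> A i"
proof -
  \<comment> \<open>The minimum of finitely many radii serves all compact sets. The cap at 1 bounds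
    the supports also far away from them.\<close>
  have "\<exists>\<epsilon>>0. \<epsilon> \<le> 1 \<and> (\<forall>K\<in>\<K>. \<forall>z\<in>K. \<exists>q\<in>K. \<forall>i<n. A i \<inter> ball z \<epsilon> \<noteq> {} \<longrightarrow> q \<in> A i)"
    using assms(1,2)
  proof (induction \<K> rule: finite_induct)
    case empty
    show ?case by (intro exI[of _ 1]) auto
  next
    case (insert K \<K>)
    have "\<exists>\<epsilon>>0. \<epsilon> \<le> 1 \<and> (\<forall>K\<in>\<K>. \<forall>z\<in>K. \<exists>q\<in>K. \<forall>i<n. A i \<inter> ball z \<epsilon> \<noteq> {} \<longrightarrow> q \<in> A i)"
      using insert.prems by (intro insert.IH) simp
    then obtain \<epsilon>1 where \<epsilon>1: "\<epsilon>1 > 0" "\<epsilon>1 \<le> 1"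
      "\<forall>K\<in>\<K>. \<forall>z\<in>K. \<exists>q\<in>K. \<forall>i<n. A i \<inter> ball z \<epsilon>1 \<noteq> {} \<longrightarrow> q \<in> A i" by metis
    obtain \<epsilon>2 where \<epsilon>2: "\<epsilon>2 > 0"
      "\<forall>z\<in>K. \<exists>q\<in>K. \<forall>i<n. A i \<inter> ball z \<epsilon>2 \<noteq> {} \<longrightarrow> q \<in> A i"
      using closed_family_near_compact[of K n A] insert.prems A by (metis insertI1)
    have sub: "ball z (min \<epsilon>1 \<epsilon>2) \<subseteq> ball z \<epsilon>1" "ball z (min \<epsilon>1 \<epsilon>2) \<subseteq> ball z \<epsilon>2" for z by auto
    show ?case
    proof (intro exI[of _ "min \<epsilon>1 \<epsilon>2"] conjI ballI)
      fix L z assume "L \<in> insert K \<K>" "z \<in> L"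
      then have "(\<exists>q\<in>L. \<forall>i<n. A i \<inter> ball z \<epsilon>1 \<noteq> {} \<longrightarrow> q \<in> A i)
          \<or> (\<exists>q\<in>L. \<forall>i<n. A i \<inter> ball z \<epsilon>2 \<noteq> {} \<longrightarrow> q \<in> A i)"
        using \<epsilon>1(3) \<epsilon>2(2) by (metis insertE)
      moreover have "A i \<inter> ball z (min \<epsilon>1 \<epsilon>2) \<noteq> {} \<Longrightarrow> A i \<inter> ball z \<epsilon>1 \<noteq> {} \<and> A i \<inter> ball z \<epsilon>2 \<noteq> {}" for i
        using sub[of z] by blast
      ultimately show "\<exists>q\<in>L. \<forall>i<n. A i \<inter> ball z (min \<epsilon>1 \<epsilon>2) \<noteq> {} \<longrightarrow> q \<in> A i"
        by meson
    qed (use \<epsilon>1 \<epsilon>2 in auto)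
  qed
  then obtain \<epsilon> where \<epsilon>: "\<epsilon> > 0" "\<epsilon> \<le> 1"
    "\<forall>K\<in>\<K>. \<forall>z\<in>K. \<exists>q\<in>K. \<forall>i<n. A i \<inter> ball z \<epsilon> \<noteq> {} \<longrightarrow> q \<in> A i" by metis
  \<comment> \<open>\<open>infdist\<close> to the empty set is 0, which would give an empty
    \<open>A i\<close> full weight everywhere; hence the case distinction.\<close>
  define f where "f = (\<lambda>i z. if A i = {} then 0 else max 0 (\<epsilon> - infdist z (A i)))"
  have near: "A i \<inter> ball z \<epsilon> \<noteq> {}" if "f i z > 0" for i z
  proof -
    have "A i \<noteq> {}" "infdist z (A i) < \<epsilon>" using that by (auto simp: f_def split: if_splits)
    then have "(INF a\<in>A i. dist z a) < \<epsilon>" by (simp add: infdist_def)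
    then obtain a where "a \<in> A i" "dist z a < \<epsilon>"
      using cInf_lessD[of "dist z ` A i" \<epsilon>] \<open>A i \<noteq> {}\<close> by blast
    then show ?thesis by auto
  qed
  show thesis
  proof (rule that[of \<epsilon> f])
    show "\<forall>i. continuous_on UNIV (f i)"
    proof
      show "continuous_on UNIV (f i)" for i
        unfolding f_def by (cases "A i = {}") (auto intro!: continuous_intros)
    qed
    show "\<forall>i. \<forall>z\<in>A i. f i z = \<epsilon>"
      using \<epsilon>(1) by (auto simp: f_def)
    show "\<forall>i z. f i z > 0 \<longrightarrow> A i \<inter> ball z 1 \<noteq> {}"
      using near subset_ball[OF \<epsilon>(2)] by blast
    show "\<forall>K\<in>\<K>. \<forall>z\<in>K. \<exists>q\<in>K. \<forall>i<n. f i z > 0 \<longrightarrow> q \<in> A i"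
      using \<epsilon>(3) near by meson
  qed (use \<epsilon> in \<open>auto simp: f_def\<close>)
qed

lemma Jordan_region_facts:
  fixes c :: "real \<Rightarrow> complex"
  assumes c: "simple_path c" "pathfinish c = pathstart c"
    and \<Phi>: "\<Phi> = inside (path_image c) \<or> \<Phi> = outside (path_image c)"
  shows "open \<Phi>" "frontier \<Phi> = path_image c" "closure \<Phi> = \<Phi> \<union> path_image c" "\<Phi> \<inter> path_image c = {}"
proof -
  note J = Jordan_inside_outside[OF c]
  show "open \<Phi>" "frontier \<Phi> = path_image c" using J \<Phi> by metis+
  then show "closure \<Phi> = \<Phi> \<union> path_image c" by (simp add: closure_Un_frontier)
  show "\<Phi> \<inter> path_image c = {}" using \<Phi> inside_no_overlap outside_no_overlap by blast
qed

text \<open>A closed side of a Jordan curve has no holes, so a nonvanishing function on it has a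
  logarithm. On the unbounded side, constancy near infinity lets \<open>h\<close> extend over the
  point at infinity, and inversion leads back to a compact set.\<close>

lemma continuous_logarithm_Jordan_region:
  fixes c :: "real \<Rightarrow> complex" and h :: "complex \<Rightarrow> complex"
  assumes c: "simple_path c" "pathfinish c = pathstart c"
    and \<Phi>: "\<Phi> = inside (path_image c) \<or> \<Phi> = outside (path_image c)"
    and h: "continuous_on (closure \<Phi>) h" "\<And>z. z \<in> closure \<Phi> \<Longrightarrow> h z \<noteq> 0"
    and const: "\<And>z. z \<in> closure \<Phi> \<Longrightarrow> norm z > B \<Longrightarrow> h z = k"
  obtains l where "continuous_on (closure \<Phi>) l" "\<And>z. z \<in> closure \<Phi> \<Longrightarrow> h z = exp (l z)"
proof -
  note J = Jordan_inside_outside[OF c]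
  note R = Jordan_region_facts[OF c \<Phi>]
  \<comment> \<open>For compact plane sets, a connected complement is equivalent to being Borsukian,
    which gives the logarithm.\<close>
  have log: "\<exists>l. continuous_on D l \<and> (\<forall>z\<in>D. g z = exp (l z))"
    if "compact D" "connected (- D)" "continuous_on D g" "\<And>z. z \<in> D \<Longrightarrow> g z \<noteq> 0" for D and g :: "complex \<Rightarrow> complex"
    using that Borsukian_separation_compact[of D] Borsukian_continuous_logarithm[of D] by blast
  show thesis
  proof (cases "\<Phi> = inside (path_image c)")
    case True
    have "- closure \<Phi> = outside (path_image c)"
      unfolding R(3) using J True by blast
    then have "connected (- closure \<Phi>)" using J by simp
    moreover have "compact (closure \<Phi>)" using J True by (simp add: compact_closure)
    ultimately show thesis using log h that by metis
  next
    case False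
    then have out: "\<Phi> = outside (path_image c)" using \<Phi> by blast
    define \<Psi> where "\<Psi> = inside (path_image c)"
    have \<Psi>: "\<Psi> = - closure \<Phi>" "open \<Psi>" "connected \<Psi>" "\<Psi> \<noteq> {}"
      unfolding R(3) \<Psi>_def using J out by blast+
    then obtain z0 r where z0: "z0 \<in> \<Psi>" "r > 0" "ball z0 r \<subseteq> \<Psi>"
      by (meson all_not_in_conv openE)
    have unb: "\<not> bounded (closure \<Phi>)" using J out bounded_subset closure_subset by metis
    then obtain z1 where "z1 \<in> closure \<Phi>" "norm z1 > B"
      unfolding bounded_iff by (meson not_le)
    then have "k \<noteq> 0" using h(2) const by metis
    \<comment> \<open>Inversion about a point inside the curve turns the exterior into a bounded region.\<close>
    define D where "D = {w. w = 0 \<or> z0 + inverse w \<in> closure \<Phi>}"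
    define g where "g = (\<lambda>w. if w = 0 then k else h (z0 + inverse w))"
    have inv: "continuous_on (- {0}) (\<lambda>w::complex. z0 + inverse w)"
      by (intro continuous_intros) auto
    have mD: "- D = (- {0}) \<inter> (\<lambda>w. z0 + inverse w) -` \<Psi>"
      unfolding D_def \<Psi>(1) by auto
    have "open (- D)"
      unfolding mD by (rule continuous_open_preimage[OF inv _ \<Psi>(2)]) auto
    moreover have "bounded D"
      unfolding bounded_iff
    proof (intro exI[of _ "inverse r"] ballI)
      fix w assume w: "w \<in> D"
      show "norm w \<le> inverse r"
      proof (cases "w = 0")
        case False
        then have "z0 + inverse w \<notin> ball z0 r" using w z0(3) \<Psi>(1) by (auto simp: D_def)
        then have "r \<le> inverse (norm w)" by (simp add: dist_norm norm_inverse)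
        then show ?thesis using False z0(2) by (simp add: field_simps)
      qed (use z0 in auto)
    qed
    ultimately have "compact D" by (simp add: compact_eq_bounded_closed closed_def)
    \<comment> \<open>The complement of \<open>D\<close> is the inverted image of the interior
      without \<open>z0\<close>; deleting a point keeps a connected open plane set
      connected.\<close>
    have "- D = (\<lambda>z. inverse (z - z0)) ` (\<Psi> - {z0})"
    proof (intro set_eqI iffI)
      fix w assume "w \<in> - D"
      then have "z0 + inverse w \<in> \<Psi> - {z0}" "w = inverse ((z0 + inverse w) - z0)" using mD by auto
      then show "w \<in> (\<lambda>z. inverse (z - z0)) ` (\<Psi> - {z0})" by blast
    qed (auto simp: mD)
    moreover have "connected ((\<lambda>z. inverse (z - z0)) ` (\<Psi> - {z0}))"
      using \<Psi> by (intro connected_continuous_image connected_open_delete continuous_intros) auto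
    ultimately have "connected (- D)" by simp
    \<comment> \<open>With this radius \<open>norm w < \<delta>\<close> forces
      \<open>norm (z0 + inverse w) > B\<close> for nonzero \<open>w\<close>, so \<open>g\<close> is
      constant near 0.\<close>
    define \<delta> where "\<delta> = inverse (\<bar>B\<bar> + norm z0 + 1)"
    have \<delta>: "\<delta> > 0" unfolding \<delta>_def by (simp add: add_nonneg_pos)
    have gk: "g w = k" if "w \<in> D \<inter> ball 0 \<delta>" for w
    proof (cases "w = 0")
      case False
      then have "norm (inverse w) > \<bar>B\<bar> + norm z0 + 1"
        using that \<delta>_def \<delta> by (simp add: norm_inverse less_imp_inverse_less[of "norm w" \<delta>, simplified])
          (metis inverse_inverse_eq less_imp_inverse_less zero_less_norm_iff)
      moreover have "norm (inverse w) \<le> norm (z0 + inverse w) + norm z0"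
        by (metis add_diff_cancel_left' norm_triangle_ineq4)
      ultimately have "norm (z0 + inverse w) > B" by simp
      then show ?thesis using const[of "z0 + inverse w"] that False by (auto simp: D_def g_def)
    qed (simp add: g_def)
    have "continuous_on ((D - {0}) \<union> (D \<inter> ball 0 \<delta>)) g"
    proof (rule continuous_on_Un_local_open)
      have eq: "(D - {0}) \<union> (D \<inter> ball 0 \<delta>) = D" using \<delta> by auto
      show "openin (top_of_set ((D - {0}) \<union> (D \<inter> ball 0 \<delta>))) (D - {0})"
        unfolding eq openin_open by (intro exI[of _ "- {0}"]) auto
      show "openin (top_of_set ((D - {0}) \<union> (D \<inter> ball 0 \<delta>))) (D \<inter> ball 0 \<delta>)"
        unfolding eq openin_open by (intro exI[of _ "ball 0 \<delta>"]) auto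
      have "continuous_on (D - {0}) (\<lambda>w. h (z0 + inverse w))"
        by (rule continuous_on_compose2[OF h(1) continuous_on_subset[OF inv]]) (auto simp: D_def)
      then show "continuous_on (D - {0}) g"
        by (rule continuous_on_eq) (auto simp: g_def)
      show "continuous_on (D \<inter> ball 0 \<delta>) g"
        by (rule continuous_on_eq[of _ "\<lambda>_. k"]) (auto simp: gk)
    qed
    moreover have "(D - {0}) \<union> (D \<inter> ball 0 \<delta>) = D" using \<delta> by auto
    ultimately have "continuous_on D g" by simp
    moreover have "g w \<noteq> 0" if "w \<in> D" for w
      using that h(2) \<open>k \<noteq> 0\<close> by (auto simp: g_def D_def)
    ultimately obtain l where l: "continuous_on D l" "\<And>w. w \<in> D \<Longrightarrow> g w = exp (l w)"
      using log[OF \<open>compact D\<close> \<open>connected (- D)\<close>] by metis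
    have ne: "z - z0 \<noteq> 0" if "z \<in> closure \<Phi>" for z using that z0(1) \<Psi>(1) by auto
    have D: "inverse (z - z0) \<in> D" if "z \<in> closure \<Phi>" for z
      using that by (simp add: D_def)
    show thesis
    proof (rule that[of "\<lambda>z. l (inverse (z - z0))"])
      show "continuous_on (closure \<Phi>) (\<lambda>z. l (inverse (z - z0)))"
        by (rule continuous_on_compose2[OF l(1)]) (use ne D in \<open>auto intro!: continuous_intros\<close>)
      show "h z = exp (l (inverse (z - z0)))" if "z \<in> closure \<Phi>" for z
        using l(2)[OF D[OF that]] ne[OF that] by (simp add: g_def)
    qed
  qed
qed


section \<open>Directions and turns\<close>

text \<open>Both angles are smaller than a right angle, so their sum stays in the range of the
  principal argument.\<close>

lemma Arg_divide_chain:
  assumes "Re (z / w) > 0" "Re (w / x) > 0"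
  shows "Arg (z / x) = Arg (z / w) + Arg (w / x)"
proof -
  have nz: "z \<noteq> 0" "w \<noteq> 0" "x \<noteq> 0" using assms by auto
  have "\<bar>Arg (z / w)\<bar> < pi / 2" "\<bar>Arg (w / x)\<bar> < pi / 2" using assms Arg_Re_pos by blast+
  then have "Arg (z / w) + Arg (w / x) \<in> {-pi<..pi}" by auto
  then have "Arg (z / w * (w / x)) = Arg (z / w) + Arg (w / x)"
    using nz by (intro Arg_times) auto
  then show ?thesis using nz by simp
qed

lemma Arg_divide_swap:
  assumes "Re (z / w) > 0"
  shows "Arg (w / z) = - Arg (z / w)"
proof -
  have "Arg (inverse (z / w)) = - Arg (z / w)"
  proof (cases "z / w \<in> \<real>")
    case True
    then have "Arg (z / w) = 0" using assms by (simp add: Arg_eq_0)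
    then show ?thesis using Arg_inverse_eq_0[of "z / w"] by simp
  qed (use Arg_inverse[of "z / w"] in simp)
  then show ?thesis by simp
qed

lemma Re_divide_swap: "Re (z / w) > 0 \<Longrightarrow> Re (w / z) > 0"
  by (metis Arg_Re_pos Arg_divide_swap abs_minus divide_eq_0_iff zero_complex.sel(1) less_irrefl)

text \<open>In the open half-plane around \<open>c\<close> every vector has an angle relative to
  \<open>c\<close>, and a turn is a difference of such angles. This makes turns cancel wherever a
  common half-plane is available.\<close>

lemma Arg_divide_half_plane:
  assumes "Re (z / c) > 0" "Re (w / c) > 0"
  shows "Arg (w / z) = Arg (w / c) - Arg (z / c)"
  using Arg_divide_chain[OF assms(2) Re_divide_swap[OF assms(1)]] Arg_divide_swap[OF assms(1)] by simp

definition cube_root :: "nat \<Rightarrow> complex" where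
  "cube_root i = (if i = 0 then 1 else Complex (-1/2) (if i = 1 then sqrt 3 / 2 else - sqrt 3 / 2))"

text \<open>The three roots add up to 0, so a pair is sent to the negative of the missing root, and
  the six nonempty proper subsets give the corners of a regular hexagon.\<close>

definition direction :: "nat set \<Rightarrow> complex" where
  "direction S = (\<Sum>i\<in>S. cube_root i)"

lemma proper_subset_cases:
  assumes "S \<subseteq> {..<3::nat}" "S \<noteq> {}" "S \<noteq> {..<3}"
  shows "S \<in> {{0}, {1}, {2}, {0,1}, {0,2}, {1,2}}"
proof -
  have "{..<3} = {0,1,2::nat}" by auto
  then have "S \<in> Pow {0,1,2}" "S \<noteq> {0,1,2}" using assms by auto
  then show ?thesis using assms(2) by (auto simp: Pow_insert)
qed

lemma norm_direction:
  assumes "S \<subseteq> {..<3}" "S \<noteq> {}" "S \<noteq> {..<3}"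
  shows "norm (direction S) = 1"
  using proper_subset_cases[OF assms]
  by (auto simp: direction_def cube_root_def cmod_def power2_eq_square)

lemma direction_compl:
  assumes "S \<subseteq> {..<3}"
  shows "direction ({..<3} - S) = - direction S"
proof -
  have "direction ({..<3} - S) + direction S = (\<Sum>i<3. cube_root i)"
    unfolding direction_def using assms by (simp add: sum.subset_diff)
  also have "\<dots> = 0" by (simp add: numeral_3_eq_3 cube_root_def complex_eq_iff)
  finally show ?thesis by (simp add: eq_neg_iff_add_eq_0)
qed

text \<open>A singleton points along its root, and a pair points 60 degrees away from each of its
  two roots.\<close>

lemma Re_direction_cube_root_pos:
  assumes "S \<subseteq> {..<3}" "S \<noteq> {..<3}" "i \<in> S"
  shows "Re (direction S / cube_root i) > 0"
proof -
  have "S \<noteq> {}" using assms by auto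
  then show ?thesis
    using proper_subset_cases[OF assms(1) _ assms(2)] assms(3)
    by (auto simp: direction_def cube_root_def Re_complex_div_gt_0)
qed

lemma Re_direction_cube_root_neg:
  assumes "S \<subseteq> {..<3}" "S \<noteq> {}" "i < 3" "i \<notin> S"
  shows "Re (direction S / (- cube_root i)) > 0"
proof -
  have "Re (direction ({..<3} - S) / cube_root i) > 0"
    by (rule Re_direction_cube_root_pos) (use assms in auto)
  then show ?thesis by (simp add: direction_compl[OF assms(1)])
qed

text \<open>Each root with positive weight makes an acute angle with \<open>direction S\<close>, and
  this survives nonnegative combinations that are not all zero. In particular the combination does
  not vanish.\<close>

lemma Re_weighted_direction_pos:
  assumes S: "S \<subseteq> {..<3}" "S \<noteq> {..<3}"
    and a: "\<And>i. a i \<ge> 0" "\<And>i. i < 3 \<Longrightarrow> a i > 0 \<Longrightarrow> i \<in> S" "\<exists>i<3. a i > 0"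
  shows "Re ((\<Sum>i<3. of_real (a i) * cube_root i) / direction S) > 0"
proof -
  have pos: "0 < b * Re (cube_root i * cnj (direction S)) \<longleftrightarrow> 0 < b" if "i \<in> S" for i b
    using Re_direction_cube_root_pos[OF S that] Re_divide_swap by (metis Re_complex_div_gt_0 zero_less_mult_pos2 mult_pos_pos)
  have "Re ((\<Sum>i<3. of_real (a i) * cube_root i) * cnj (direction S)) = (\<Sum>i<3. a i * Re (cube_root i * cnj (direction S)))"
    by (simp add: sum_distrib_right sum_distrib_left sum.distrib algebra_simps)
  also have "\<dots> > 0"
  proof -
    obtain k where k: "k < 3" "a k > 0" using a(3) by blast
    have nn: "a i * Re (cube_root i * cnj (direction S)) \<ge> 0" if "i \<in> {..<3}" for i
    proof (cases "a i > 0")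
      case True
      then show ?thesis using pos[of i "a i"] a(2)[of i] that by force
    next
      case False
      then show ?thesis using a(1)[of i] by simp
    qed
    show ?thesis
      by (rule sum_pos2[of _ k]) (use k pos[of k] a(2) nn in auto)
  qed
  finally show ?thesis by (simp add: Re_complex_div_gt_0)
qed

text \<open>From the weighted sum to \<open>direction S\<close> and from there to
  \<open>cube_root k\<close> the angle is less than a right angle each time, so the total stays
  below half a turn. Hence the principal logarithm of the quotient is continuous in the
  weights.\<close>

lemma weighted_direction_avoids_ray:
  assumes S: "S \<subseteq> {..<3}" "S \<noteq> {..<3}" "k \<in> S"
    and a: "\<And>i. a i \<ge> 0" "\<And>i. i < 3 \<Longrightarrow> a i > 0 \<Longrightarrow> i \<in> S" "\<exists>i<3. a i > 0"
  shows "(\<Sum>i<3. of_real (a i) * cube_root i) / cube_root k \<notin> \<real>\<^sub>\<le>\<^sub>0"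
proof -
  define h where "h = (\<Sum>i<3. of_real (a i) * cube_root i)"
  have pos: "Re (h / direction S) > 0" "Re (direction S / cube_root k) > 0"
    unfolding h_def by (rule Re_weighted_direction_pos Re_direction_cube_root_pos; use assms in blast)+
  then have "Arg (h / cube_root k) = Arg (h / direction S) + Arg (direction S / cube_root k)"
    by (rule Arg_divide_chain)
  moreover have "\<bar>Arg (h / direction S)\<bar> < pi / 2" "\<bar>Arg (direction S / cube_root k)\<bar> < pi / 2"
    using pos Arg_Re_pos by blast+
  ultimately have "Arg (h / cube_root k) \<noteq> pi" by linarith
  moreover have "h / cube_root k \<noteq> 0" using pos by auto
  ultimately show ?thesis
    unfolding h_def[symmetric] Arg_eq_pi complex_nonpos_Reals_iff
    by (metis complex_eqI less_eq_real_def zero_complex.sel)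
qed

text \<open>A discrete Green formula: every cell has no net turn, and summing over all cells cancels
  the inner sides, leaving the boundary of the grid.\<close>

lemma grid_boundary_sum:
  fixes H W :: "nat \<Rightarrow> nat \<Rightarrow> real"
  assumes "\<And>i j. i < m \<Longrightarrow> j < n \<Longrightarrow> H i j + W (Suc i) j = H i (Suc j) + W i j"
  shows "(\<Sum>i<m. H i 0) + (\<Sum>j<n. W m j) = (\<Sum>i<m. H i n) + (\<Sum>j<n. W 0 j)"
proof -
  have row: "(\<Sum>i<m. H i j) + W m j = (\<Sum>i<m. H i (Suc j)) + W 0 j" if "j < n" for j
    using assms that by (induction m) (fastforce simp: algebra_simps)+
  have "(\<Sum>i<m. H i 0) + (\<Sum>j<k. W m j) = (\<Sum>i<m. H i k) + (\<Sum>j<k. W 0 j)" if "k \<le> n" for k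
    using that
  proof (induction k)
    case (Suc k)
    then show ?case using row[of k] by simp
  qed simp
  then show ?thesis by blast
qed

text \<open>The parity count. Comparing each turn with a difference of fixed angles leaves twelve
  integers \<open>n i j k\<close>, one for each edge and each vertex off it. Every one of them
  occurs in exactly one triangle relation and exactly one square relation.\<close>

lemma no_turning_system_on_K4:
  fixes s :: "nat \<Rightarrow> nat \<Rightarrow> complex" and T :: "nat \<Rightarrow> nat \<Rightarrow> nat \<Rightarrow> real"
  assumes s: "\<And>i j. i < j \<Longrightarrow> j < 4 \<Longrightarrow> norm (s i j) = 1" "\<And>i j. i < j \<Longrightarrow> j < 4 \<Longrightarrow> s j i = - s i j"
    and T: "\<And>i j k. i < j \<Longrightarrow> j < 4 \<Longrightarrow> k < 4 \<Longrightarrow> k \<noteq> i \<Longrightarrow> k \<noteq> j \<Longrightarrow> cis (T i j k) = s j k / s i k"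
    and tri: "\<And>i j k l. i < j \<Longrightarrow> j < k \<Longrightarrow> k < 4 \<Longrightarrow> l < 4 \<Longrightarrow> l \<notin> {i,j,k} \<Longrightarrow> T i j l + T j k l = T i k l"
    and sq: "\<And>i j k l. i < j \<Longrightarrow> j < 4 \<Longrightarrow> k < l \<Longrightarrow> l < 4 \<Longrightarrow> {i,j} \<inter> {k,l} = {} \<Longrightarrow>
      T i j k + T k l j = T i j l + T k l i"
  shows False
proof -
  \<comment> \<open>The angle is chosen freely for \<open>i < j\<close>; the reversed pair receives
    exactly half a turn more, in accordance with the antipodal condition on
    \<open>s\<close>.\<close>
  define \<theta> where "\<theta> = (\<lambda>i j. if i < j then Arg (s i j) else Arg (s j i) + pi)"
  have \<theta>: "cis (\<theta> i j) = s i j" if "i \<noteq> j" "i < 4" "j < 4" for i j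
  proof -
    have *: "cis (Arg (s a b)) = s a b" if "a < b" "b < 4" for a b
      using s(1)[OF that] cis_Arg[of "s a b"] by (cases "s a b = 0") (auto simp: sgn_eq)
    show ?thesis
    proof (cases "i < j")
      case False
      then have "cis (\<theta> i j) = - s j i" using that * by (simp add: \<theta>_def flip: cis_mult)
      then show ?thesis using False that s(2)[of j i] by simp
    qed (use that * in \<open>simp add: \<theta>_def\<close>)
  qed
  have "\<exists>n::int. T i j k = \<theta> j k - \<theta> i k + 2 * pi * n" if "i < j" "j < 4" "k < 4" "k \<noteq> i" "k \<noteq> j" for i j k
  proof -
    have "cis (T i j k) = cis (\<theta> j k - \<theta> i k)"
      using T[OF that] \<theta>[of j k] \<theta>[of i k] that by (simp add: cis_divide[symmetric])
    then have "sin (T i j k) = sin (\<theta> j k - \<theta> i k) \<and> cos (T i j k) = cos (\<theta> j k - \<theta> i k)"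
      by (simp add: complex_eq_iff)
    then show ?thesis using sin_cos_eq_iff by (metis mult.commute mult.left_commute)
  qed
  then obtain n :: "nat \<Rightarrow> nat \<Rightarrow> nat \<Rightarrow> int" where n:
    "\<And>i j k. i < j \<Longrightarrow> j < 4 \<Longrightarrow> k < 4 \<Longrightarrow> k \<noteq> i \<Longrightarrow> k \<noteq> j \<Longrightarrow> T i j k = \<theta> j k - \<theta> i k + 2 * pi * n i j k"
    by metis
  have tri_n: "n i j l + n j k l = n i k l" if "i < j" "j < k" "k < 4" "l < 4" "l \<notin> {i,j,k}" for i j k l
  proof -
    have "2 * pi * (n i j l + n j k l - n i k l) = 0"
      using tri[OF that] n[of i j l] n[of j k l] n[of i k l] that by (simp add: algebra_simps)
    then show ?thesis by simp
  qed
  have \<theta>_flip: "\<theta> j i = \<theta> i j + pi" if "i < j" for i j using that by (simp add: \<theta>_def)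
  have "2 * pi * (n 0 1 2 + n 2 3 1 - n 0 1 3 - n 2 3 0) = 0"
    using sq[of 0 1 2 3] n[of 0 1 2] n[of 2 3 1] n[of 0 1 3] n[of 2 3 0]
      \<theta>_flip[of 0 2] \<theta>_flip[of 1 2] \<theta>_flip[of 0 3] \<theta>_flip[of 1 3]
    by (simp add: algebra_simps)
  \<comment> \<open>In each square four half turns appear. They cancel in the other two squares, but
    for the interleaved pairs 02 and 13 they leave one full turn, the \<open>+ 1\<close>.\<close>
  moreover have "2 * pi * (n 0 2 1 + n 1 3 2 - n 0 2 3 - n 1 3 0 + 1) = 0"
    using sq[of 0 2 1 3] n[of 0 2 1] n[of 1 3 2] n[of 0 2 3] n[of 1 3 0]
      \<theta>_flip[of 0 1] \<theta>_flip[of 0 3] \<theta>_flip[of 1 2] \<theta>_flip[of 2 3]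
    by (simp add: algebra_simps)
  moreover have "2 * pi * (n 0 3 1 + n 1 2 3 - n 0 3 2 - n 1 2 0) = 0"
    using sq[of 0 3 1 2] n[of 0 3 1] n[of 1 2 3] n[of 0 3 2] n[of 1 2 0]
      \<theta>_flip[of 0 1] \<theta>_flip[of 0 2] \<theta>_flip[of 1 3] \<theta>_flip[of 2 3]
    by (simp add: algebra_simps)
  ultimately have "n 0 1 2 + n 2 3 1 - n 0 1 3 - n 2 3 0 = 0" "n 0 2 1 + n 1 3 2 - n 0 2 3 - n 1 3 0 + 1 = 0"
    "n 0 3 1 + n 1 2 3 - n 0 3 2 - n 1 2 0 = 0" by (simp_all flip: of_int_add of_int_diff)
  moreover have "n 0 1 3 + n 1 2 3 = n 0 2 3" "n 0 1 2 + n 1 3 2 = n 0 3 2" "n 0 2 1 + n 2 3 1 = n 0 3 1"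
    "n 1 2 0 + n 2 3 0 = n 1 3 0"
    using tri_n[of 0 1 2 3] tri_n[of 0 1 3 2] tri_n[of 0 2 3 1] tri_n[of 1 2 3 0] by simp_all
  \<comment> \<open>Modulo 2, adding the three square and four triangle relations makes every
    \<open>n\<close> appear twice, and the single 1 remains.\<close>
  ultimately show False by presburger
qed


section \<open>The side of a cycle that a vertex does not lie on\<close>

text \<open>Values of \<open>d\<close> differ by integer multiples of 2 pi i, so a continuous
  \<open>d\<close> has discrete range.\<close>

lemma exp_constant_imp_constant:
  fixes d :: "complex \<Rightarrow> complex"
  assumes "connected S" "continuous_on S d" "\<And>z. z \<in> S \<Longrightarrow> exp (d z) = c" "z \<in> S" "w \<in> S"
  shows "d z = d w"
proof -
  have "d constant_on S"
  proof (rule continuous_discrete_range_constant[OF assms(1,2)])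
    fix z assume z: "z \<in> S"
    have "2 * pi \<le> norm (d w - d z)" if w: "w \<in> S" "d w \<noteq> d z" for w
    proof (rule ccontr)
      assume "\<not> 2 * pi \<le> norm (d w - d z)"
      then have "\<bar>Im (d w) - Im (d z)\<bar> < 2 * pi"
        using abs_Im_le_cmod[of "d w - d z"] by simp
      moreover have "exp (d w) = exp (d z)" using assms(3)[OF z] assms(3)[OF w(1)] by simp
      ultimately show False using exp_complex_eqI w(2) by blast
    qed
    then show "\<exists>e>0. \<forall>w. w \<in> S \<and> d w \<noteq> d z \<longrightarrow> e \<le> norm (d w - d z)"
      by (intro exI[of _ "2 * pi"]) auto
  qed
  then show ?thesis using assms(4,5) unfolding constant_on_def by metis
qed

text \<open>\<open>above i v w\<close> means that \<open>v\<close> is larger than \<open>w\<close> in the \<open>i\<close>-th order.\<close>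

locale three_orders = plane_map M for M :: "('v, 'e) planar_map" +
  fixes above :: "nat \<Rightarrow> 'v \<Rightarrow> 'v \<Rightarrow> bool"
  assumes above_linear: "i < 3 \<Longrightarrow> v \<in> V \<Longrightarrow> w \<in> V \<Longrightarrow> v \<noteq> w \<Longrightarrow> above i w v \<longleftrightarrow> \<not> above i v w"
    and above_some: "v \<in> V \<Longrightarrow> w \<in> V \<Longrightarrow> v \<noteq> w \<Longrightarrow> \<exists>i<3. above i v w"
    and above_face: "v \<in> V \<Longrightarrow> F \<in> faces M \<Longrightarrow> point M v \<notin> frontier F \<Longrightarrow>
      \<exists>i<3. \<forall>u\<in>V. point M u \<in> frontier F \<longrightarrow> above i v u"
begin

definition above_set :: "'v \<Rightarrow> 'v \<Rightarrow> nat set" where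
  "above_set v w = {i. i < 3 \<and> above i v w}"

definition heading :: "'v \<Rightarrow> 'v \<Rightarrow> complex" where
  "heading v w = direction (above_set v w)"

lemma above_set_proper:
  assumes "v \<in> V" "w \<in> V" "v \<noteq> w"
  shows "above_set v w \<subseteq> {..<3}" "above_set v w \<noteq> {}" "above_set v w \<noteq> {..<3}"
proof -
  show "above_set v w \<subseteq> {..<3}" by (auto simp: above_set_def)
  show "above_set v w \<noteq> {}" using above_some[OF assms] by (auto simp: above_set_def)
  obtain i where "i < 3" "above i w v" using above_some[of w v] assms by auto
  then have "i \<notin> above_set v w" using above_linear[of i v w] assms by (auto simp: above_set_def)
  then show "above_set v w \<noteq> {..<3}" using \<open>i < 3\<close> by auto
qed

lemma heading_swap:
  assumes "v \<in> V" "w \<in> V" "v \<noteq> w"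
  shows "heading w v = - heading v w"
proof -
  have "above_set w v = {..<3} - above_set v w"
    using above_linear[of _ v w] assms by (auto simp: above_set_def)
  then show ?thesis using direction_compl above_set_proper(1)[OF assms] by (simp add: heading_def)
qed

lemma norm_heading: "v \<in> V \<Longrightarrow> w \<in> V \<Longrightarrow> v \<noteq> w \<Longrightarrow> norm (heading v w) = 1"
  using above_set_proper norm_direction by (simp add: heading_def)

end

section \<open>Colouring a side of a cycle as seen from a vertex outside its closure\<close>

locale seen_region = three_orders M above for M :: "('v, 'e) planar_map" and above +
  fixes c :: "real \<Rightarrow> complex" and \<Phi> :: "complex set" and C :: "'e set" and x :: 'v
  assumes c: "simple_path c" "pathfinish c = pathstart c"
    and \<Phi>: "\<Phi> = inside (path_image c) \<or> \<Phi> = outside (path_image c)"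
    and C: "C \<subseteq> E" "path_image c = (\<Union>e\<in>C. path_image (curve M e))"
    and x: "x \<in> V" "point M x \<notin> closure \<Phi>"
begin

lemmas region = Jordan_region_facts[OF c \<Phi>]

lemma frontier_region: "frontier \<Phi> \<subseteq> drawing M"
  using region(2) C by (auto simp: drawing_def)

lemma curve_in_closure: "e \<in> C \<Longrightarrow> path_image (curve M e) \<subseteq> closure \<Phi>"
  using region(3) C by auto

lemma frontier_face_in_closure: "F \<subseteq> \<Phi> \<Longrightarrow> frontier F \<subseteq> closure \<Phi>"
  using closure_mono by (auto simp: frontier_def)

lemma mem_frontier_face: "F \<in> faces M \<Longrightarrow> p \<in> closure F \<Longrightarrow> p \<in> drawing M \<Longrightarrow> p \<in> frontier F"
  using face_facts(1,4) by (auto simp: frontier_def interior_open)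

text \<open>No face in \<open>\<Phi>\<close> has \<open>x\<close> on its frontier, so in some order
  \<open>x\<close> lies above all its vertices. Committing to one order per face leaves a point of
  \<open>\<Phi>\<close> off the drawing with a single colour.\<close>

definition colour :: "complex set \<Rightarrow> nat" where
  "colour F = (SOME i. i < 3 \<and> (\<forall>u\<in>V. point M u \<in> frontier F \<longrightarrow> above i x u))"

lemma colour:
  assumes "F \<in> faces M" "F \<subseteq> \<Phi>"
  shows "colour F < 3" "\<And>u. u \<in> V \<Longrightarrow> point M u \<in> frontier F \<Longrightarrow> above (colour F) x u"
proof -
  have "point M x \<notin> frontier F" using frontier_face_in_closure assms x by blast
  then have "\<exists>i. i < 3 \<and> (\<forall>u\<in>V. point M u \<in> frontier F \<longrightarrow> above i x u)"
    using above_face[OF x(1) assms(1)] by blast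
  from someI_ex[OF this, folded colour_def]
  show "colour F < 3" "\<And>u. u \<in> V \<Longrightarrow> point M u \<in> frontier F \<Longrightarrow> above (colour F) x u" by blast+
qed

text \<open>The midpoint of the curve is not a vertex, so a face of \<open>\<Phi>\<close> touching
  it has the whole edge in its frontier.\<close>

lemma face_along_edge:
  assumes e: "e \<in> C"
  obtains F where "F \<in> faces M" "F \<subseteq> \<Phi>" "path_image (curve M e) \<subseteq> frontier F"
proof -
  have eE: "e \<in> E" using e C by blast
  define p where "p = curve M e (1/2)"
  have p: "p \<in> path_image (curve M e)" by (auto simp: p_def path_image_def)
  have inj: "s = t \<or> s = 0 \<and> t = 1 \<or> s = 1 \<and> t = 0"
    if "curve M e s = curve M e t" "s \<in> {0..1}" "t \<in> {0..1}" for s t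
    using curve_facts(1)[OF eE] that unfolding simple_path_def loop_free_def by blast
  have "p \<notin> {pathstart (curve M e), pathfinish (curve M e)}"
    using inj[of "1/2" 0] inj[of "1/2" 1] unfolding p_def pathstart_def pathfinish_def by auto
  then have pV: "p \<notin> point M ` V" using curve_facts(2,3)[OF eE] p by blast
  obtain F where F: "F \<in> faces M" "F \<subseteq> \<Phi>" "p \<in> closure F"
    using closure_open_covered_by_faces[OF region(1) frontier_region, of p] curve_in_closure[OF e] p by blast
  have "p \<in> drawing M" using p eE by (auto simp: drawing_def)
  then have "path_image (curve M e) \<subseteq> frontier F"
    using edge_subset_frontier_face[OF eE F(1) p pV] mem_frontier_face F by blast
  then show thesis using that F by blast
qed

text \<open>The colour of a face of \<open>\<Phi>\<close> along the edge serves as \<open>i\<close>.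
  A common index puts the headings from both ends into one half-plane.\<close>

lemma edge_below:
  assumes "e \<in> C" "ends (graph M) e = {u, w}"
  obtains i where "i \<in> above_set x u" "i \<in> above_set x w"
proof -
  have e: "e \<in> E" using assms C by blast
  obtain F where F: "F \<in> faces M" "F \<subseteq> \<Phi>" "path_image (curve M e) \<subseteq> frontier F"
    using face_along_edge[OF assms(1)] .
  have "u \<in> V" "w \<in> V" "point M u \<in> frontier F" "point M w \<in> frontier F"
    using curve_facts(3,4)[OF e] assms(2) F(3) by auto
  then show thesis using that[of "colour F"] colour[OF F(1,2)] by (auto simp: above_set_def)
qed

definition coloured :: "nat \<Rightarrow> complex set" where
  "coloured i = (\<Union>F\<in>{F \<in> faces M. F \<subseteq> \<Phi> \<and> colour F = i}. closure F)"

lemma closed_coloured: "closed (coloured i)"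
  unfolding coloured_def by (rule closed_Union_closure_faces) auto

lemma coloured_cover:
  assumes "p \<in> closure \<Phi>"
  obtains i where "i < 3" "p \<in> coloured i"
proof -
  obtain F where F: "F \<in> faces M" "F \<subseteq> \<Phi>" "p \<in> closure F"
    using closure_open_covered_by_faces[OF region(1) frontier_region assms] .
  then have "p \<in> coloured (colour F)" by (auto simp: coloured_def)
  then show thesis using that colour(1)[OF F(1,2)] by blast
qed

lemma coloured_above:
  assumes "p \<in> coloured i" "u \<in> V" "\<And>F. F \<in> faces M \<Longrightarrow> p \<in> closure F \<Longrightarrow> point M u \<in> frontier F"
  shows "i \<in> above_set x u"
proof -
  obtain F where F: "F \<in> faces M" "F \<subseteq> \<Phi>" "colour F = i" "p \<in> closure F"
    using assms(1) unfolding coloured_def by blast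
  then show ?thesis using colour[OF F(1,2)] assms(2,3) by (simp add: above_set_def)
qed

text \<open>A point of the drawing can be replaced by a vertex that inherits all its colours: the
  point itself, or else an end of the edge through it, since a face touching an inner point of an
  edge has that whole edge in its frontier. By the last conclusion, a point on an edge of the cycle
  is replaced by an end of this edge.\<close>

lemma coloured_vertex:
  assumes "p \<in> drawing M" "p \<in> closure \<Phi>"
  obtains u where "u \<in> V" "point M u \<in> closure \<Phi>" "\<And>i. i < 3 \<Longrightarrow> p \<in> coloured i \<Longrightarrow> i \<in> above_set x u"
    "\<And>e. e \<in> C \<Longrightarrow> p \<in> path_image (curve M e) \<Longrightarrow> u \<in> ends (graph M) e"
proof (cases "p \<in> point M ` V")
  case True
  then obtain u where u: "u \<in> V" "p = point M u" by auto
  have "i \<in> above_set x u" if "i < 3" "p \<in> coloured i" for i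
    by (rule coloured_above[OF that(2) u(1)]) (use mem_frontier_face assms u in simp)
  moreover have "u \<in> ends (graph M) e" if "e \<in> C" "p \<in> path_image (curve M e)" for e
  proof -
    have "e \<in> E" using that C by auto
    then have "point M u \<in> point M ` ends (graph M) e" "ends (graph M) e \<subseteq> V"
      using curve_facts(3,4)[of e] that u by auto
    then show ?thesis using inj_point u by (auto dest: inj_onD)
  qed
  ultimately show thesis using that u assms by blast
next
  case False
  then obtain e where e: "e \<in> E" "p \<in> path_image (curve M e)" using assms by (auto simp: drawing_def)
  have ends: "ends (graph M) e \<subseteq> V" "point M ` ends (graph M) e \<subseteq> path_image (curve M e)"
    using curve_facts(3,4)[OF e(1)] by auto
  obtain u where u: "u \<in> ends (graph M) e" using curve_facts(2)[OF e(1)] by blast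
  have onF: "point M u \<in> frontier F" if "F \<in> faces M" "p \<in> closure F" for F
    using edge_subset_frontier_face[OF e(1) that(1) e(2) False] mem_frontier_face that assms ends u by blast
  obtain F where F: "F \<in> faces M" "F \<subseteq> \<Phi>" "p \<in> closure F"
    using closure_open_covered_by_faces[OF region(1) frontier_region assms(2)] .
  have "point M u \<in> closure \<Phi>" using onF F frontier_face_in_closure by blast
  moreover have "i \<in> above_set x u" if "i < 3" "p \<in> coloured i" for i
    by (rule coloured_above[OF that(2)]) (use onF u ends in auto)
  moreover have "u \<in> ends (graph M) e'" if "e' \<in> C" "p \<in> path_image (curve M e')" for e'
    using curve_facts(5)[OF e(1), of e'] that C False e(2) u by blast
  ultimately show thesis using that u ends by blast
qed

text \<open>On the drawing, three colours would pass to a vertex lying below \<open>x\<close> in all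
  orders, which is impossible. Off the drawing only one face, hence one colour, is present.\<close>

lemma coloured_not_all:
  assumes "p \<in> closure \<Phi>"
  shows "{i. i < 3 \<and> p \<in> coloured i} \<noteq> {..<3}"
proof
  assume all: "{i. i < 3 \<and> p \<in> coloured i} = {..<3}"
  show False
  proof (cases "p \<in> drawing M")
    case True
    then obtain u where u: "u \<in> V" "point M u \<in> closure \<Phi>" "\<And>i. i < 3 \<Longrightarrow> p \<in> coloured i \<Longrightarrow> i \<in> above_set x u"
      using coloured_vertex assms by metis
    then have "u \<noteq> x" using x by auto
    then have "above_set x u \<noteq> {..<3}" "above_set x u \<subseteq> {..<3}" using above_set_proper u x by auto
    then show False using u(3) all by blast
  next
    case False
    have "F = F'" if "F \<in> faces M" "F' \<in> faces M" "p \<in> closure F" "p \<in> closure F'" for F F'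
    proof -
      have "p \<in> F" "p \<in> F'"
        using that False face_facts(5) closure_Un_frontier by blast+
      then show ?thesis using that components_eq unfolding faces_def by blast
    qed
    then have "i = j" if "p \<in> coloured i" "p \<in> coloured j" for i j
      using that unfolding coloured_def by blast
    moreover have "0 \<in> {i. i < 3 \<and> p \<in> coloured i}" "1 \<in> {i. i < 3 \<and> p \<in> coloured i}"
      unfolding all by simp_all
    ultimately have "(0::nat) = 1" by blast
    then show False by simp
  qed
qed

lemma unbounded_face:
  obtains B F0 where "drawing M \<subseteq> cball 0 B" "F0 \<in> faces M" "- cball 0 B \<subseteq> F0"
proof -
  obtain B where B: "drawing M \<subseteq> cball 0 B"
    using compact_imp_bounded[OF compact_drawing] by (auto simp: bounded_iff subset_iff)
  have "connected (- cball (0::complex) B)"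
    by (rule connected_complement_bounded_convex) auto
  moreover have "- cball (0::complex) B \<noteq> {}"
    by (metis bounded_cball boolean_algebra.compl_zero double_compl not_bounded_UNIV)
  ultimately obtain F0 where "F0 \<in> components (- drawing M)" "- cball 0 B \<subseteq> F0"
    using B exists_component_superset[of "- cball 0 B" "- drawing M"] by blast
  then show thesis using that B by (simp add: faces_def)
qed

text \<open>The potential is a consistent choice of an angle for \<open>heading x u\<close>. The
  colours are blended into a nonvanishing \<open>h\<close> on \<open>closure \<Phi>\<close>, whose
  logarithm supplies the angle. That increments along edges of the cycle are the principal ones
  means that the heading makes no net turn along it.\<close>

lemma turning_potential:
  obtains t :: "'v \<Rightarrow> real"
  where "\<And>e u w. e \<in> C \<Longrightarrow> ends (graph M) e = {u, w} \<Longrightarrow> t w - t u = Arg (heading x w / heading x u)"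
proof -
  obtain B F0 where B: "drawing M \<subseteq> cball 0 B" and F0: "F0 \<in> faces M" "- cball 0 B \<subseteq> F0"
    using unbounded_face .
  define V' where "V' = {u \<in> V. point M u \<in> closure \<Phi>}"
  \<comment> \<open>Overlaps of colours are controlled on three kinds of sets: the bounded part of
    the region, where not all colours meet; each edge, where an end carries the colours present; and
    each vertex, where they lie in its own \<open>above_set\<close>.\<close>
  define \<K> where "\<K> = {closure \<Phi> \<inter> cball 0 (B + 1)} \<union> (\<lambda>e. path_image (curve M e)) ` C \<union> (\<lambda>u. {point M u}) ` V'"
  have fin: "finite \<K>" using C(1) finite_VE finite_subset[OF C(1)] by (auto simp: \<K>_def V'_def)
  have comp: "compact K" if "K \<in> \<K>" for K
    using that C(1) curve_facts(1) compact_simple_path_image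
    by (auto simp: \<K>_def intro: closed_Int_compact)
  obtain \<epsilon> and f :: "nat \<Rightarrow> complex \<Rightarrow> real" where
    "\<epsilon> > 0" "\<forall>i. continuous_on UNIV (f i)" "\<forall>i z. f i z \<ge> 0"
    "\<forall>i. \<forall>z\<in>coloured i. f i z = \<epsilon>" "\<forall>i z. f i z > 0 \<longrightarrow> coloured i \<inter> ball z 1 \<noteq> {}"
    "\<forall>K\<in>\<K>. \<forall>z\<in>K. \<exists>q\<in>K. \<forall>i<3. f i z > 0 \<longrightarrow> q \<in> coloured i"
    by (rule bump_functions_closed_family[of \<K> 3 coloured, OF fin comp closed_coloured])
  note f = this[rule_format]
  define h where "h = (\<lambda>z. \<Sum>i<3. of_real (f i z) * cube_root i)"
  define k where "k = of_real \<epsilon> * cube_root (colour F0)"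
  have nz: "cube_root i \<noteq> 0" for i by (simp add: cube_root_def complex_eq_iff)
  have some: "\<exists>i<3. f i z > 0" if "z \<in> closure \<Phi>" for z
  proof -
    obtain i where "i < 3" "z \<in> coloured i" using coloured_cover[OF \<open>z \<in> closure \<Phi>\<close>] .
    then show ?thesis using f(1,4) by auto
  qed
  \<comment> \<open>Everything within distance 1 of such a point lies in the face \<open>F0\<close>
    around infinity, so only the colour of \<open>F0\<close> has positive weight.\<close>
  have far: "h z = k" if z: "z \<in> closure \<Phi>" "norm z > B + 1" for z
  proof -
    have "z \<in> F0" "z \<notin> drawing M" using z B F0(2) by auto
    then have "z \<in> \<Phi>" using z region(3) C(1) C(2) by (auto simp: drawing_def)
    then have "F0 \<subseteq> \<Phi>"
      using connected_Int_frontier[of F0 \<Phi>] face_facts[OF F0(1)] \<open>z \<in> F0\<close> frontier_region by blast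
    then have "z \<in> coloured (colour F0)"
      using F0(1) \<open>z \<in> F0\<close> closure_subset by (auto simp: coloured_def)
    then have eps: "f (colour F0) z = \<epsilon>" by (rule f(4))
    have zero: "f i z = 0" if i: "i \<noteq> colour F0" for i
    proof (rule ccontr)
      assume "f i z \<noteq> 0"
      then have "f i z > 0" using f(3)[of i z] by simp
      then obtain a F where a: "dist z a < 1" "F \<in> faces M" "colour F = i" "a \<in> closure F"
        using f(5)[of i z] unfolding coloured_def mem_ball[symmetric] by blast
      have "norm z \<le> norm a + dist z a" by (simp add: dist_norm norm_triangle_sub)
      then have "a \<in> F0" using F0(2) a(1) z(2) by (intro subsetD[OF F0(2)]) auto
      then have "F \<inter> F0 \<noteq> {}"
        using a(4) face_facts(1)[OF F0(1)] by (metis IntI empty_iff inf_commute open_Int_closure_eq_empty)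
      then have "F = F0" using components_eq a(2) F0(1) unfolding faces_def by blast
      then show False using a(3) i by simp
    qed
    have "h z = (\<Sum>i<3. if i = colour F0 then k else 0)"
      unfolding h_def k_def by (intro sum.cong refl) (use eps zero in auto)
    then show ?thesis using colour(1)[OF F0(1) \<open>F0 \<subseteq> \<Phi>\<close>] by simp
  qed
  have weights: "Re (h z / direction S) > 0" if "z \<in> closure \<Phi>" "S \<subseteq> {..<3}" "S \<noteq> {..<3}"
    "\<And>i. i < 3 \<Longrightarrow> f i z > 0 \<Longrightarrow> i \<in> S" for z S
    unfolding h_def by (rule Re_weighted_direction_pos[OF that(2,3)]) (use that some f(3) in auto)
  \<comment> \<open>In the bounded part, the active colours occur together at some point of the
    region and hence are not all three.\<close>
  have "h z \<noteq> 0" if z: "z \<in> closure \<Phi>" for z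
  proof (cases "norm z > B + 1")
    case True
    then show ?thesis using far z f(1) nz by (simp add: k_def)
  next
    case False
    then have "z \<in> closure \<Phi> \<inter> cball 0 (B + 1)" using z by simp
    moreover have "closure \<Phi> \<inter> cball 0 (B + 1) \<in> \<K>" by (simp add: \<K>_def)
    ultimately obtain q where q: "q \<in> closure \<Phi>" "\<forall>i<3. f i z > 0 \<longrightarrow> q \<in> coloured i"
      using f(6) by blast
    have "Re (h z / direction {i. i < 3 \<and> q \<in> coloured i}) > 0"
      by (rule weights[OF z _ coloured_not_all[OF q(1)]]) (use q in auto)
    then show ?thesis by auto
  qed
  moreover have "continuous_on (closure \<Phi>) h"
    unfolding h_def using f(2) by (intro continuous_intros) (auto intro: continuous_on_subset)
  ultimately obtain l where l: "continuous_on (closure \<Phi>) l" "\<And>z. z \<in> closure \<Phi> \<Longrightarrow> h z = exp (l z)"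
    using continuous_logarithm_Jordan_region[OF c \<Phi>, of h "B + 1" k] far by metis
  \<comment> \<open>\<open>Im (l (point M u))\<close> is an angle of \<open>h\<close> at the vertex;
    the second summand rotates it to an angle of the heading.\<close>
  define t where "t = (\<lambda>u. Im (l (point M u)) + Arg (heading x u / h (point M u)))"
  have "t w - t u = Arg (heading x w / heading x u)" if e: "e \<in> C" "ends (graph M) e = {u, w}" for e u w
  proof -
    define S where "S = path_image (curve M e)"
    have eE: "e \<in> E" using e C by blast
    have S: "S \<subseteq> closure \<Phi>" "S \<in> \<K>" using e curve_in_closure by (auto simp: S_def \<K>_def)
    have SD: "S \<subseteq> drawing M" using eE by (auto simp: S_def drawing_def)
    have uw: "u \<in> V" "w \<in> V" "point M u \<in> S" "point M w \<in> S"
      using curve_facts(3,4)[OF eE] e by (auto simp: S_def)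
    then have V': "u \<in> V'" "w \<in> V'" using S by (auto simp: V'_def)
    have proper: "above_set x v \<subseteq> {..<3}" "above_set x v \<noteq> {..<3}" if "v \<in> V'" for v
      using above_set_proper[of x v] x that by (auto simp: V'_def)
    obtain i where i: "i \<in> above_set x u" "i \<in> above_set x w" using edge_below[OF e] .
    \<comment> \<open>The colours active at \<open>p\<close> occur together on the same edge, hence
      all lie in the \<open>above_set\<close> of one end \<open>v\<close>, and this set also
      contains \<open>i\<close>.\<close>
    have ray: "h p / cube_root i \<notin> \<real>\<^sub>\<le>\<^sub>0" if p: "p \<in> S" for p
    proof -
      obtain q where q: "q \<in> S" "\<forall>j<3. f j p > 0 \<longrightarrow> q \<in> coloured j" using f(6)[OF S(2) p] by blast
      obtain v where v: "\<And>j. j < 3 \<Longrightarrow> q \<in> coloured j \<Longrightarrow> j \<in> above_set x v" "v \<in> {u, w}"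
        using coloured_vertex[of q] q(1) S(1) SD e unfolding S_def by (metis subsetD)
      show ?thesis unfolding h_def
        by (rule weighted_direction_avoids_ray[of "above_set x v"]) (use v q proper V' i some S p f(3) in auto)
    qed
    \<comment> \<open>Away from the ray opposite to the root, \<open>Ln\<close> gives a second
      continuous logarithm of \<open>h\<close> up to a constant factor, so the difference from
      \<open>l\<close> is constant along the edge.\<close>
    have cont: "continuous_on S (\<lambda>p. l p - Ln (h p / cube_root i))"
      using l(1) \<open>continuous_on (closure \<Phi>) h\<close> S(1) ray nz
      by (intro continuous_intros) (auto intro: continuous_on_subset)
    have exp: "exp (l p - Ln (h p / cube_root i)) = cube_root i" if "p \<in> S" for p
      using that l(2) S(1) nz by (auto simp: exp_diff)
    have "connected S"
      using curve_facts(1)[OF eE] by (simp add: S_def connected_simple_path_image)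
    from exp_constant_imp_constant[OF this cont exp uw(3,4)] have "Im (l (point M u) - Ln (h (point M u) / cube_root i)) = Im (l (point M w) - Ln (h (point M w) / cube_root i))"
      by simp
    moreover have nonzero: "h p / cube_root i \<noteq> 0" if "p \<in> S" for p using ray[OF that] by auto
    ultimately have K: "Im (l (point M u)) - Arg (h (point M u) / cube_root i) = Im (l (point M w)) - Arg (h (point M w) / cube_root i)"
      using Arg_eq_Im_Ln[OF nonzero[OF uw(3)]] Arg_eq_Im_Ln[OF nonzero[OF uw(4)]] by simp
    \<comment> \<open>Relative to the axis \<open>cube_root i\<close>, the first two terms agree at
      both ends by \<open>K\<close>, so only the angle of the heading changes.\<close>
    have t: "t v = Im (l (point M v)) - Arg (h (point M v) / cube_root i) + Arg (heading x v / cube_root i)"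
      and pos: "Re (heading x v / cube_root i) > 0"
      if v: "v \<in> V'" "i \<in> above_set x v" for v
    proof -
      have "{point M v} \<in> \<K>" using v by (simp add: \<K>_def)
      then have *: "\<forall>j<3. f j (point M v) > 0 \<longrightarrow> point M v \<in> coloured j" using f(6) by fastforce
      have inD: "point M v \<in> closure \<Phi>" "point M v \<in> drawing M" using v by (auto simp: V'_def drawing_def)
      have above: "j \<in> above_set x v" if "j < 3" "point M v \<in> coloured j" for j
        by (rule coloured_above[OF that(2)]) (use mem_frontier_face inD v in \<open>auto simp: V'_def\<close>)
      have 1: "Re (h (point M v) / heading x v) > 0"
        unfolding heading_def by (rule weights) (use inD proper[OF v(1)] * above in auto)
      show 2: "Re (heading x v / cube_root i) > 0"
        unfolding heading_def by (rule Re_direction_cube_root_pos) (use proper[OF v(1)] v in auto)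
      show "t v = Im (l (point M v)) - Arg (h (point M v) / cube_root i) + Arg (heading x v / cube_root i)"
        using Arg_divide_chain[OF 1 2] Arg_divide_swap[OF 1] by (simp add: t_def)
    qed
    show ?thesis
      using t[OF V'(1) i(1)] t[OF V'(2) i(2)] K Arg_divide_half_plane[OF pos[OF V'(1) i(1)] pos[OF V'(2) i(2)]]
      by simp
  qed
  then show thesis using that by blast
qed

end


section \<open>Subdivisions of the complete graph on four vertices\<close>

context plane_map
begin

lemma edge_arc:
  assumes e: "e \<in> E" "ends (graph M) e = {u, w}" "u \<noteq> w"
  obtains g where "arc g" "pathstart g = point M u" "pathfinish g = point M w" "path_image g = path_image (curve M e)"
proof -
  have "u \<in> V" "w \<in> V" using curve_facts(4)[OF e(1)] e(2) by auto
  then have ne: "point M u \<noteq> point M w" using inj_point e(3) by (auto dest: inj_onD)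
  have se: "{pathstart (curve M e), pathfinish (curve M e)} = {point M u, point M w}"
    using curve_facts(2)[OF e(1)] e(2) by simp
  then have "pathstart (curve M e) \<noteq> pathfinish (curve M e)" using ne by (auto simp: doubleton_eq_iff)
  then have "arc (curve M e)" using curve_facts(1)[OF e(1)] by (simp add: arc_simple_path)
  then show thesis
    using that[of "curve M e"] that[of "reversepath (curve M e)"] se
    by (auto simp: doubleton_eq_iff arc_reversepath)
qed

lemma point_on_path_image:
  assumes "length xs = Suc (length es)" "set es \<subseteq> E"
    "\<forall>i<length es. ends (graph M) (es ! i) = {xs ! i, xs ! Suc i}"
    and v: "v \<in> V" "point M v \<in> (\<Union>e\<in>set es. path_image (curve M e))"
  shows "v \<in> set xs"
proof -
  obtain i where i: "i < length es" "point M v \<in> path_image (curve M (es ! i))"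
    using v(2) by (auto simp: in_set_conv_nth)
  then have E: "es ! i \<in> E" using assms(2) by auto
  have "point M v \<in> point M ` ends (graph M) (es ! i)"
    using curve_facts(3)[OF E] i(2) v(1) by blast
  then have "v \<in> ends (graph M) (es ! i)"
    using curve_facts(4)[OF E] inj_point v(1) by (auto dest: inj_onD)
  then show ?thesis using assms(1,3) i(1) by auto
qed

text \<open>Induction along the path: the first curve meets the later ones only in vertices, and
  such a vertex is on the remaining list, which leaves only \<open>w\<close>.\<close>

lemma graph_path_arc:
  assumes "es \<noteq> []" "length xs = Suc (length es)" "set es \<subseteq> E"
    "\<forall>i<length es. ends (graph M) (es ! i) = {xs ! i, xs ! Suc i}" "distinct xs"
  shows "\<exists>g. arc g \<and> pathstart g = point M (hd xs) \<and> pathfinish g = point M (last xs) \<and>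
    path_image g = (\<Union>e\<in>set es. path_image (curve M e))"
  using assms
proof (induction es arbitrary: xs)
  case (Cons e es)
  obtain u w ys where xs: "xs = u # w # ys"
    using Cons.prems(2) by (metis Suc_length_conv length_Cons)
  have e: "e \<in> E" "ends (graph M) e = {u, w}" "u \<noteq> w"
    using Cons.prems(3,4,5) xs by auto
  obtain g where g: "arc g" "pathstart g = point M u" "pathfinish g = point M w" "path_image g = path_image (curve M e)"
    using edge_arc[OF e] .
  show ?case
  proof (cases "es = []")
    case True
    then have "ys = []" using Cons.prems(2) xs by simp
    then show ?thesis using g True xs by (intro exI[of _ g]) auto
  next
    case False
    have len: "length (w # ys) = Suc (length es)" using Cons.prems(2) xs by simp
    have esE: "set es \<subseteq> E" using Cons.prems(3) by simp
    have ends: "\<forall>i<length es. ends (graph M) (es ! i) = {(w # ys) ! i, (w # ys) ! Suc i}"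
    proof (intro allI impI)
      fix i assume "i < length es"
      then show "ends (graph M) (es ! i) = {(w # ys) ! i, (w # ys) ! Suc i}"
        using Cons.prems(4)[rule_format, of "Suc i"] xs by simp
    qed
    have dist: "distinct (w # ys)" "u \<notin> set (w # ys)" using Cons.prems(5) xs by auto
    obtain g' where g': "arc g'" "pathstart g' = point M w" "pathfinish g' = point M (last (w # ys))"
      "path_image g' = (\<Union>e\<in>set es. path_image (curve M e))"
      using Cons.IH[OF False len esE ends dist(1)] by auto
    have "e \<notin> set es"
    proof
      assume "e \<in> set es"
      then obtain i where "i < length es" "es ! i = e" by (auto simp: in_set_conv_nth)
      then have "{u, w} = {(w # ys) ! i, (w # ys) ! Suc i}" using ends e(2) by metis
      moreover have "(w # ys) ! i \<in> set (w # ys)" "(w # ys) ! Suc i \<in> set (w # ys)"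
        using \<open>i < length es\<close> len by (intro nth_mem; simp)+
      ultimately show False using dist(2) by (metis insertI1 insertE singletonD)
    qed
    have "path_image g \<inter> path_image g' \<subseteq> {pathstart g'}"
    proof
      fix z assume z: "z \<in> path_image g \<inter> path_image g'"
      then obtain e' where e': "e' \<in> set es" "z \<in> path_image (curve M e')" "z \<in> path_image (curve M e)"
        using g(4) g'(4) by auto
      then have "z \<in> point M ` V" using curve_facts(5)[OF e(1), of e'] esE \<open>e \<notin> set es\<close> by blast
      then obtain v where v: "v \<in> V" "z = point M v" by auto
      then have "v \<in> set (w # ys)"
        using point_on_path_image[OF len esE ends, of v] z g'(4) by blast
      moreover have "v \<in> {u, w}"
        using curve_facts(3,4)[OF e(1)] e(2) e'(3) v inj_point by (auto dest: inj_onD)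
      ultimately show "z \<in> {pathstart g'}" using dist(2) v g'(2) by auto
    qed
    then have "arc (g +++ g')" using g g' by (intro arc_join) auto
    moreover have "path_image (g +++ g') = (\<Union>e\<in>set (e # es). path_image (curve M e))"
      using g g' by (simp add: path_image_join)
    ultimately show ?thesis using g g' xs by (intro exI[of _ "g +++ g'"]) auto
  qed
qed simp

end

text \<open>What remains is the image of a half-open interval. This is applied to the three paths
  leaving a branch vertex, cut off before their far ends.\<close>

lemma arc_minus_finish_connected:
  fixes g :: "real \<Rightarrow> complex"
  assumes "arc g"
  shows "connected (path_image g - {pathfinish g})"
proof -
  have "path_image g - {pathfinish g} = g ` {0..<1}"
  proof -
    have "inj_on g {0..1}" using assms by (simp add: arc_def)
    then have "g ` ({0..1} - {1}) = g ` {0..1} - g ` {1}" by (intro inj_on_image_set_diff[where C = "{0..1}"]) auto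
    moreover have "{0..1::real} - {1} = {0..<1}" by auto
    ultimately show ?thesis by (simp add: path_image_def pathfinish_def)
  qed
  moreover have "continuous_on {0..<1} g"
    using assms by (auto simp: arc_def path_def intro: continuous_on_subset)
  ultimately show ?thesis by (simp add: connected_continuous_image)
qed

lemma simple_path_triangle:
  assumes g: "arc g1" "arc g2" "arc g3" "pathstart g1 = a" "pathfinish g1 = b" "pathstart g2 = b" "pathfinish g2 = c"
    "pathstart g3 = c" "pathfinish g3 = a"
    and "path_image g1 \<inter> path_image g2 \<subseteq> {b}" "path_image g2 \<inter> path_image g3 \<subseteq> {c}" "path_image g3 \<inter> path_image g1 \<subseteq> {a}"
  shows "\<exists>h. simple_path h \<and> pathfinish h = pathstart h \<and> path_image h = path_image g1 \<union> path_image g2 \<union> path_image g3"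
proof (intro exI conjI)
  have "arc (g1 +++ g2)" using assms by (intro arc_join) auto
  then show "simple_path ((g1 +++ g2) +++ g3)"
    using assms by (intro simple_path_join_loop) (auto simp: path_image_join)
qed (use g in \<open>auto simp: path_image_join\<close>)

section \<open>Paths and cycles of the subdivision inside the map\<close>

definition K4_edges :: "nat set set" where
  "K4_edges = {e. e \<subseteq> {..<4} \<and> card e = 2}"

lemma K4_edge: "i < 4 \<Longrightarrow> j < 4 \<Longrightarrow> i \<noteq> j \<Longrightarrow> {i, j} \<in> K4_edges"
  by (auto simp: K4_edges_def)

lemma K4_edgeE:
  assumes "e \<in> K4_edges"
  obtains i j where "e = {i, j}" "i < 4" "j < 4" "i \<noteq> j"
  using assms by (auto simp: K4_edges_def card_2_iff)

text \<open>Disjointness of inner vertices is restated for whole vertex lists, so that it applies to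
  any vertex of a path, ends included.\<close>

locale K4_in_map = three_orders M above for M :: "('v, 'e) planar_map" and above +
  fixes f :: "nat \<Rightarrow> 'v" and xs :: "nat set \<Rightarrow> 'v list" and es :: "nat set \<Rightarrow> 'e list"
  assumes inj_f: "inj_on f {..<4}" and f_V: "f ` {..<4} \<subseteq> V"
    and path: "e \<in> K4_edges \<Longrightarrow> es e \<noteq> []" "e \<in> K4_edges \<Longrightarrow> length (xs e) = Suc (length (es e))"
      "e \<in> K4_edges \<Longrightarrow> set (xs e) \<subseteq> V" "e \<in> K4_edges \<Longrightarrow> set (es e) \<subseteq> E"
      "e \<in> K4_edges \<Longrightarrow> \<forall>i<length (es e). ends (graph M) (es e ! i) = {xs e ! i, xs e ! Suc i}"
      "e \<in> K4_edges \<Longrightarrow> distinct (xs e)"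
    and path_ends: "e \<in> K4_edges \<Longrightarrow> {hd (xs e), last (xs e)} = f ` e"
    and path_branch: "e \<in> K4_edges \<Longrightarrow> set (xs e) \<inter> f ` {..<4} \<subseteq> f ` e"
    and path_inter: "e \<in> K4_edges \<Longrightarrow> e' \<in> K4_edges \<Longrightarrow> e \<noteq> e' \<Longrightarrow> set (xs e) \<inter> set (xs e') \<subseteq> f ` (e \<inter> e')"
    and path_edges: "e \<in> K4_edges \<Longrightarrow> e' \<in> K4_edges \<Longrightarrow> e \<noteq> e' \<Longrightarrow> set (es e) \<inter> set (es e') = {}"
begin

lemma f_eq: "i < 4 \<Longrightarrow> j < 4 \<Longrightarrow> f i = f j \<longleftrightarrow> i = j"
  using inj_f by (auto dest: inj_onD)

lemma f_in_V: "i < 4 \<Longrightarrow> f i \<in> V"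
  using f_V by auto

definition trace :: "nat set \<Rightarrow> complex set" where
  "trace e = (\<Union>e'\<in>set (es e). path_image (curve M e'))"

lemma trace_arc:
  assumes "i < 4" "j < 4" "i \<noteq> j"
  obtains g where "arc g" "pathstart g = point M (f i)" "pathfinish g = point M (f j)" "path_image g = trace {i, j}"
proof -
  have e: "{i, j} \<in> K4_edges" using K4_edge assms by blast
  obtain g where g: "arc g" "pathstart g = point M (hd (xs {i, j}))" "pathfinish g = point M (last (xs {i, j}))"
    "path_image g = trace {i, j}"
    using graph_path_arc[OF path(1,2,4-6)[OF e]] unfolding trace_def by blast
  have "{hd (xs {i, j}), last (xs {i, j})} = {f i, f j}" using path_ends[OF e] by simp
  then show thesis
    using that[of g] that[of "reversepath g"] g by (auto simp: doubleton_eq_iff arc_reversepath)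
qed

lemma trace_inter:
  assumes "e \<in> K4_edges" "e' \<in> K4_edges" "e \<noteq> e'"
  shows "trace e \<inter> trace e' \<subseteq> (\<lambda>i. point M (f i)) ` (e \<inter> e')"
proof
  fix z assume z: "z \<in> trace e \<inter> trace e'"
  then obtain d d' where d: "d \<in> set (es e)" "d' \<in> set (es e')" "z \<in> path_image (curve M d)" "z \<in> path_image (curve M d')"
    by (auto simp: trace_def)
  have "d \<noteq> d'" "d \<in> E" "d' \<in> E" using d path_edges[OF assms] path(4) assms by auto
  then have "z \<in> point M ` V" using curve_facts(5)[of d d'] d by blast
  then obtain v where v: "v \<in> V" "z = point M v" by auto
  then have "v \<in> set (xs e)" "v \<in> set (xs e')"
    using point_on_path_image[OF path(2,4,5)] z assms unfolding trace_def by blast+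
  then show "z \<in> (\<lambda>i. point M (f i)) ` (e \<inter> e')" using path_inter[OF assms] v by auto
qed

lemma point_in_trace:
  assumes "e \<in> K4_edges" "v \<in> set (xs e)"
  shows "point M v \<in> trace e"
proof -
  obtain a where a: "a < length (xs e)" "xs e ! a = v" using assms(2) by (auto simp: in_set_conv_nth)
  obtain b where b: "b < length (es e)" "a = b \<or> a = Suc b"
  proof (cases a)
    case 0
    then show ?thesis using that[of 0] path(1)[OF assms(1)] by auto
  next
    case (Suc b)
    then show ?thesis using that[of b] a path(2)[OF assms(1)] by auto
  qed
  then have d: "es e ! b \<in> set (es e)" "es e ! b \<in> E" "v \<in> ends (graph M) (es e ! b)"
    using path(4,5)[OF assms(1)] a by auto
  have "point M v \<in> path_image (curve M (es e ! b))"
    using curve_facts(3)[OF d(2)] d(3) by blast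
  then show ?thesis using d(1) unfolding trace_def by blast
qed

definition cycle :: "nat \<Rightarrow> 'e set" where
  "cycle l = (\<Union>e\<in>{e \<in> K4_edges. l \<notin> e}. set (es e))"

text \<open>The three paths from \<open>f l\<close> without their far ends form a connected set
  \<open>Y\<close> off the cycle, so some side of the cycle misses \<open>Y\<close>. This one side
  is seen from every vertex drawn in \<open>Y\<close>, not only from \<open>f l\<close>.\<close>

lemma region_of_cycle:
  assumes l: "l < 4"
  obtains c \<Phi> where "\<And>m v. m < 4 \<Longrightarrow> m \<noteq> l \<Longrightarrow> v \<in> set (xs {l, m}) \<Longrightarrow> v \<noteq> f m \<Longrightarrow>
    seen_region M above c \<Phi> (cycle l) v"
proof -
  obtain i j k where ijk: "{..<4} - {l} = {i, j, k}" "i \<noteq> j" "j \<noteq> k" "k \<noteq> i"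
  proof -
    have "card ({..<4} - {l}) = 3" using l by simp
    then show ?thesis using that by (auto simp: card_3_iff)
  qed
  then have lt: "i < 4" "j < 4" "k < 4" "l \<noteq> i" "l \<noteq> j" "l \<noteq> k" by auto
  have not_l: "{e \<in> K4_edges. l \<notin> e} = {{i, j}, {j, k}, {k, i}}" (is "?A = ?B")
  proof
    show "?A \<subseteq> ?B"
    proof
      fix e assume e: "e \<in> ?A"
      then have "e \<in> K4_edges" by simp
      then obtain a b where ab: "e = {a, b}" "a < 4" "b < 4" "a \<noteq> b" by (rule K4_edgeE)
      then have "a \<in> {i, j, k}" "b \<in> {i, j, k}" using e ijk(1) by auto
      then show "e \<in> ?B" using ab by auto
    qed
    show "?B \<subseteq> ?A" using lt ijk by (auto intro: K4_edge)
  qed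
  have K: "{i, j} \<in> K4_edges" "{j, k} \<in> K4_edges" "{k, i} \<in> K4_edges" using not_l by auto
  obtain g1 where g1: "arc g1" "pathstart g1 = point M (f i)" "pathfinish g1 = point M (f j)" "path_image g1 = trace {i, j}"
    using trace_arc[of i j] lt ijk by blast
  obtain g2 where g2: "arc g2" "pathstart g2 = point M (f j)" "pathfinish g2 = point M (f k)" "path_image g2 = trace {j, k}"
    using trace_arc[of j k] lt ijk by blast
  obtain g3 where g3: "arc g3" "pathstart g3 = point M (f k)" "pathfinish g3 = point M (f i)" "path_image g3 = trace {k, i}"
    using trace_arc[of k i] lt ijk by blast
  have "{i, j} \<noteq> {j, k}" "{j, k} \<noteq> {k, i}" "{k, i} \<noteq> {i, j}" using ijk by (auto simp: doubleton_eq_iff)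
  then have "path_image g1 \<inter> path_image g2 \<subseteq> {point M (f j)}" "path_image g2 \<inter> path_image g3 \<subseteq> {point M (f k)}"
    "path_image g3 \<inter> path_image g1 \<subseteq> {point M (f i)}"
    using trace_inter[OF K(1,2)] trace_inter[OF K(2,3)] trace_inter[OF K(3,1)] g1(4) g2(4) g3(4) ijk by auto
  then obtain c where c: "simple_path c" "pathfinish c = pathstart c"
    "path_image c = trace {i, j} \<union> trace {j, k} \<union> trace {k, i}"
    using simple_path_triangle[OF g1(1) g2(1) g3(1) g1(2,3) g2(2,3) g3(2,3)] g1(4) g2(4) g3(4) by auto
  have c_cycle: "path_image c = (\<Union>e\<in>cycle l. path_image (curve M e))" "cycle l \<subseteq> E"
    unfolding cycle_def not_l c(3) trace_def using path(4) K by auto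
  define Y where "Y = (\<Union>m\<in>{i, j, k}. trace {l, m} - {point M (f m)})"
  have "connected Y"
    unfolding Y_def
  proof (rule connected_Union)
    fix S assume "S \<in> (\<lambda>m. trace {l, m} - {point M (f m)}) ` {i, j, k}"
    then obtain m where m: "m < 4" "m \<noteq> l" "S = trace {l, m} - {point M (f m)}" using lt by auto
    obtain g where "arc g" "pathfinish g = point M (f m)" "path_image g = trace {l, m}"
      using trace_arc[OF l m(1)] m(2) by metis
    then show "connected S" using arc_minus_finish_connected[of g] m(3) by simp
  next
    have "point M (f l) \<in> trace {l, m} - {point M (f m)}" if m: "m \<in> {i, j, k}" for m
    proof -
      have m': "m < 4" "m \<noteq> l" using m lt by auto
      obtain g where g: "arc g" "pathstart g = point M (f l)" "path_image g = trace {l, m}"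
        using trace_arc[OF l m'(1)] m'(2) by metis
      have "point M (f l) \<noteq> point M (f m)"
        using inj_point f_in_V f_eq l m' by (metis inj_on_eq_iff)
      then show ?thesis using g pathstart_in_path_image[of g] by simp
    qed
    then show "\<Inter> ((\<lambda>m. trace {l, m} - {point M (f m)}) ` {i, j, k}) \<noteq> {}" by blast
  qed
  moreover have disj: "Y \<inter> path_image c = {}"
  proof -
    have "(trace {l, m} - {point M (f m)}) \<inter> trace e = {}" if "m \<in> {i, j, k}" "e \<in> {e \<in> K4_edges. l \<notin> e}" for m e
    proof -
      have "{l, m} \<in> K4_edges" using that(1) lt l K4_edge by auto
      then have "trace {l, m} \<inter> trace e \<subseteq> (\<lambda>i. point M (f i)) ` ({l, m} \<inter> e)"
        using that(2) by (intro trace_inter) auto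
      also have "\<dots> \<subseteq> {point M (f m)}" using that(2) by auto
      finally show ?thesis by blast
    qed
    then show ?thesis unfolding Y_def c(3) not_l by blast
  qed
  ultimately obtain \<Phi> where \<Phi>: "\<Phi> = inside (path_image c) \<or> \<Phi> = outside (path_image c)" "\<Phi> \<inter> Y = {}"
  proof (cases "Y \<inter> inside (path_image c) = {}")
    case False
    note J = Jordan_inside_outside[OF c(1,2)]
    have "Y \<subseteq> inside (path_image c)"
    proof (rule ccontr)
      assume "\<not> Y \<subseteq> inside (path_image c)"
      then have "Y \<inter> frontier (inside (path_image c)) \<noteq> {}"
        using connected_Int_frontier[OF \<open>connected Y\<close> False] by blast
      then show False using J disj by auto
    qed
    then have "outside (path_image c) \<inter> Y = {}" using J by blast
    then show ?thesis using that by blast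
  qed (use that in blast)
  have "seen_region M above c \<Phi> (cycle l) v"
    if m: "m < 4" "m \<noteq> l" and v: "v \<in> set (xs {l, m})" "v \<noteq> f m" for m v
  proof -
    have K: "{l, m} \<in> K4_edges" using m l K4_edge by auto
    have vV: "v \<in> V" using v path(3)[OF K] by blast
    have "point M v \<noteq> point M (f m)" using inj_point vV f_in_V[OF m(1)] v(2) by (metis inj_on_eq_iff)
    moreover have "m \<in> {i, j, k}" using m ijk(1) by blast
    ultimately have "point M v \<in> Y" using point_in_trace[OF K v(1)] unfolding Y_def by blast
    then have "point M v \<notin> closure \<Phi>"
      using Jordan_region_facts(3)[OF c(1,2) \<Phi>(1)] \<Phi>(2) disj by blast
    then show ?thesis using c \<Phi> c_cycle vV by unfold_locales auto
  qed
  then show thesis using that by blast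
qed

text \<open>Naming the ends of \<open>e'\<close> so that \<open>v\<close> differs from
  \<open>f k\<close> puts \<open>v\<close> on a path leaving \<open>f l\<close>, short of its far
  end. As \<open>e\<close> avoids \<open>l\<close>, the edge \<open>d\<close> lies on the cycle
  opposite to \<open>l\<close>, and \<open>v\<close> sees the far side of that cycle.\<close>

lemma opposite_edge_below:
  assumes e: "e \<in> K4_edges" "e' \<in> K4_edges" "e \<inter> e' = {}"
    and d: "d \<in> set (es e)" "ends (graph M) d = {u, w}" and v: "v \<in> set (xs e')"
  obtains i where "i \<in> above_set v u" "i \<in> above_set v w"
proof -
  obtain k l where kl: "e' = {k, l}" "k < 4" "l < 4" "k \<noteq> l" using e(2) by (rule K4_edgeE)
  have "\<exists>k l. e' = {l, k} \<and> k < 4 \<and> l < 4 \<and> k \<noteq> l \<and> v \<noteq> f k"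
  proof (cases "v = f k")
    case True
    then have "v \<noteq> f l" using f_eq kl by simp
    then show ?thesis using kl by blast
  next
    case False
    then show ?thesis using kl by (metis insert_commute)
  qed
  then obtain k l where kl: "e' = {l, k}" "k < 4" "l < 4" "k \<noteq> l" "v \<noteq> f k" by blast
  obtain c \<Phi> where "seen_region M above c \<Phi> (cycle l) v"
    using region_of_cycle[OF kl(3)] kl v by metis
  then interpret seen_region M above c \<Phi> "cycle l" v .
  have "d \<in> cycle l" using d e kl by (auto simp: cycle_def)
  then show thesis using edge_below[OF _ d(2)] that by blast
qed

lemma cycle_potential:
  assumes "l < 4"
  obtains t :: "'v \<Rightarrow> real" where "\<And>e d u w. e \<in> K4_edges \<Longrightarrow> l \<notin> e \<Longrightarrow> d \<in> set (es e) \<Longrightarrow> ends (graph M) d = {u, w} \<Longrightarrow>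
    t w - t u = Arg (heading (f l) w / heading (f l) u)"
proof -
  \<comment> \<open>Any second branch index; it only exhibits \<open>f l\<close> as a vertex of a
    path leaving \<open>f l\<close>.\<close>
  define m where "m = (if l = 0 then 1 else 0 :: nat)"
  have m: "m < 4" "m \<noteq> l" by (auto simp: m_def)
  have K: "{l, m} \<in> K4_edges" using K4_edge m assms by auto
  have "f l \<in> {hd (xs {l, m}), last (xs {l, m})}" using path_ends[OF K] by auto
  moreover have "xs {l, m} \<noteq> []" using path(2)[OF K] by auto
  ultimately have "f l \<in> set (xs {l, m})" by auto
  moreover have "f l \<noteq> f m" using f_eq m assms by auto
  ultimately obtain c \<Phi> where "seen_region M above c \<Phi> (cycle l) (f l)"
    using region_of_cycle[OF assms] m by metis
  then interpret seen_region M above c \<Phi> "cycle l" "f l" .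
  obtain t where t: "\<And>e u w. e \<in> cycle l \<Longrightarrow> ends (graph M) e = {u, w} \<Longrightarrow> t w - t u = Arg (heading (f l) w / heading (f l) u)"
    using turning_potential by blast
  show thesis
  proof (rule that[of t])
    fix e d u w assume "e \<in> K4_edges" "l \<notin> e" "d \<in> set (es e)" "ends (graph M) d = {u, w}"
    then show "t w - t u = Arg (heading (f l) w / heading (f l) u)" by (intro t) (auto simp: cycle_def)
  qed
qed

end

section \<open>Turns along the paths of the subdivision\<close>

lemma cis_sum_Arg_divide:
  assumes "\<And>a. a \<le> n \<Longrightarrow> norm (z a) = 1"
  shows "cis (\<Sum>a<n. Arg (z (Suc a) / z a)) = z n / z 0"
  using assms
proof (induction n)
  case 0
  then have "z 0 \<noteq> 0" by force
  then show ?case by simp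
next
  case (Suc n)
  have nz: "z n \<noteq> 0" "z (Suc n) \<noteq> 0" using Suc.prems[of n] Suc.prems[of "Suc n"] by force+
  have "norm (z (Suc n) / z n) = 1" using Suc.prems[of n] Suc.prems[of "Suc n"] by (simp add: norm_divide)
  then have "cis (Arg (z (Suc n) / z n)) = z (Suc n) / z n"
    using cis_Arg[of "z (Suc n) / z n"] nz by (simp add: sgn_eq)
  then show ?case using Suc.IH Suc.prems nz by (simp flip: cis_mult)
qed

context K4_in_map
begin

text \<open>Paths are indexed by unordered pairs and may be listed either way, whereas a turn has a
  sense.\<close>

definition oriented :: "nat \<Rightarrow> nat \<Rightarrow> 'v list" where
  "oriented i j = (if hd (xs {i, j}) = f i then xs {i, j} else rev (xs {i, j}))"

definition steps :: "nat \<Rightarrow> nat \<Rightarrow> nat" where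
  "steps i j = length (es {i, j})"

lemma oriented:
  assumes "i < 4" "j < 4" "i \<noteq> j"
  shows "oriented i j ! 0 = f i" "oriented i j ! steps i j = f j"
    "a \<le> steps i j \<Longrightarrow> oriented i j ! a \<in> set (xs {i, j})"
    "a < steps i j \<Longrightarrow> \<exists>d\<in>set (es {i, j}). ends (graph M) d = {oriented i j ! a, oriented i j ! Suc a}"
proof -
  have e: "{i, j} \<in> K4_edges" using K4_edge assms by blast
  note len = path(2)[OF e]
  have ne: "xs {i, j} \<noteq> []" using len by auto
  have ends: "{hd (xs {i, j}), last (xs {i, j})} = {f i, f j}" using path_ends[OF e] by simp
  have ij: "f i \<noteq> f j" using f_eq assms by simp
  have hl: "hd (xs {i, j}) = xs {i, j} ! 0" "last (xs {i, j}) = xs {i, j} ! steps i j"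
    using ne len by (simp_all add: hd_conv_nth last_conv_nth steps_def)
  have step: "\<exists>d\<in>set (es {i, j}). ends (graph M) d = {xs {i, j} ! a, xs {i, j} ! Suc a}" if "a < steps i j" for a
    using path(5)[OF e] that by (intro bexI[of _ "es {i, j} ! a"]) (auto simp: steps_def)
  have rev: "rev (xs {i, j}) ! a = xs {i, j} ! (steps i j - a)" if "a \<le> steps i j" for a
    using that len by (simp add: rev_nth steps_def)
  show "oriented i j ! 0 = f i" "oriented i j ! steps i j = f j"
    using ends ij hl rev[of 0] rev[of "steps i j"] by (auto simp: oriented_def doubleton_eq_iff)
  show "oriented i j ! a \<in> set (xs {i, j})" if "a \<le> steps i j"
    using that len rev[OF that] by (auto simp: oriented_def steps_def)
  show "\<exists>d\<in>set (es {i, j}). ends (graph M) d = {oriented i j ! a, oriented i j ! Suc a}" if a: "a < steps i j"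
  proof (cases "hd (xs {i, j}) = f i")
    case True
    then show ?thesis using step[OF a] by (simp add: oriented_def)
  next
    case False
    have "steps i j - Suc a < steps i j" using a by simp
    moreover have "Suc (steps i j - Suc a) = steps i j - a" using a by simp
    ultimately obtain d where "d \<in> set (es {i, j})"
      "ends (graph M) d = {xs {i, j} ! (steps i j - Suc a), xs {i, j} ! (steps i j - a)}"
      using step by metis
    then show ?thesis using False a rev[of a] rev[of "Suc a"] by (auto simp: oriented_def)
  qed
qed

lemma oriented_V: "i < 4 \<Longrightarrow> j < 4 \<Longrightarrow> i \<noteq> j \<Longrightarrow> a \<le> steps i j \<Longrightarrow> oriented i j ! a \<in> V"
  using oriented(3) path(3) K4_edge by blast

text \<open>Adding principal arguments step by step keeps the full turns that the argument of the
  total quotient would lose.\<close>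

definition turn :: "nat \<Rightarrow> nat \<Rightarrow> nat \<Rightarrow> real" where
  "turn i j k = (\<Sum>a<steps i j. Arg (heading (oriented i j ! Suc a) (f k) / heading (oriented i j ! a) (f k)))"

lemma oriented_not_branch:
  assumes "i < 4" "j < 4" "i \<noteq> j" "k < 4" "k \<noteq> i" "k \<noteq> j" "a \<le> steps i j"
  shows "oriented i j ! a \<noteq> f k"
proof
  assume "oriented i j ! a = f k"
  then have "f k \<in> f ` {i, j}"
    using oriented(3)[OF assms(1,2,3,7)] path_branch[OF K4_edge[OF assms(1-3)]] assms(4) by auto
  then show False using f_eq assms by auto
qed

text \<open>Exchanging the arguments negates both headings and leaves their quotient alone. This
  connects \<open>turn\<close> with \<open>cycle_potential\<close>, where the fixed vertex comes
  first.\<close>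

lemma turn_swap:
  assumes "i < 4" "j < 4" "i \<noteq> j" "k < 4" "k \<noteq> i" "k \<noteq> j"
  shows "turn i j k = (\<Sum>a<steps i j. Arg (heading (f k) (oriented i j ! Suc a) / heading (f k) (oriented i j ! a)))"
  unfolding turn_def
proof (intro sum.cong refl)
  fix a assume "a \<in> {..<steps i j}"
  then have "heading (f k) (oriented i j ! a) = - heading (oriented i j ! a) (f k)"
    "heading (f k) (oriented i j ! Suc a) = - heading (oriented i j ! Suc a) (f k)"
    using oriented_not_branch[OF assms] oriented_V[OF assms(1-3)] f_in_V[OF assms(4)]
    by (auto intro!: heading_swap)
  then show "Arg (heading (oriented i j ! Suc a) (f k) / heading (oriented i j ! a) (f k)) =
      Arg (heading (f k) (oriented i j ! Suc a) / heading (f k) (oriented i j ! a))" by simp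
qed

lemma cis_turn:
  assumes "i < 4" "j < 4" "i \<noteq> j" "k < 4" "k \<noteq> i" "k \<noteq> j"
  shows "cis (turn i j k) = heading (f j) (f k) / heading (f i) (f k)"
proof -
  have "norm (heading (oriented i j ! a) (f k)) = 1" if "a \<le> steps i j" for a
    using oriented_not_branch[OF assms that] oriented_V[OF assms(1-3) that] f_in_V[OF assms(4)] norm_heading by blast
  then show ?thesis
    using cis_sum_Arg_divide[of "steps i j" "\<lambda>a. heading (oriented i j ! a) (f k)"] oriented(1,2)[OF assms(1-3)]
    by (simp add: turn_def)
qed

text \<open>The potential on the cycle opposite to \<open>l\<close> makes each turn the difference
  of its values at the two branch vertices.\<close>

lemma turn_triangle:
  assumes "i < j" "j < k" "k < 4" "l < 4" "l \<notin> {i, j, k}"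
  shows "turn i j l + turn j k l = turn i k l"
proof -
  obtain t :: "'v \<Rightarrow> real" where t: "\<And>e d u w. e \<in> K4_edges \<Longrightarrow> l \<notin> e \<Longrightarrow> d \<in> set (es e) \<Longrightarrow> ends (graph M) d = {u, w} \<Longrightarrow>
    t w - t u = Arg (heading (f l) w / heading (f l) u)"
    using cycle_potential[OF assms(4)] by blast
  have "turn a b l = t (f b) - t (f a)" if ab: "a < 4" "b < 4" "a \<noteq> b" "l \<noteq> a" "l \<noteq> b" for a b
  proof -
    have "turn a b l = (\<Sum>n<steps a b. t (oriented a b ! Suc n) - t (oriented a b ! n))"
      unfolding turn_swap[OF ab(1-3) assms(4) ab(4,5)]
    proof (intro sum.cong refl)
      fix n assume "n \<in> {..<steps a b}"
      then obtain d where "d \<in> set (es {a, b})" "ends (graph M) d = {oriented a b ! n, oriented a b ! Suc n}"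
        using oriented(4)[OF ab(1-3)] by auto
      then show "Arg (heading (f l) (oriented a b ! Suc n) / heading (f l) (oriented a b ! n)) =
          t (oriented a b ! Suc n) - t (oriented a b ! n)"
        using t[OF K4_edge[OF ab(1-3)]] ab by auto
    qed
    also have "\<dots> = t (f b) - t (f a)"
      using oriented(1,2)[OF ab(1-3)] sum_lessThan_telescope[of "\<lambda>n. t (oriented a b ! n)" "steps a b"] by simp
    finally show ?thesis .
  qed
  then show ?thesis using assms by simp
qed

text \<open>The indices for \<open>x\<close> and \<open>y\<close> differ from those for
  \<open>u\<close> and \<open>w\<close>, because an index cannot serve both directions of a pair.
  With only three indices, one of the two pairs must coincide, and the shared index yields the axis:
  its root, or the negative of its root.\<close>

lemma common_half_plane:
  assumes V: "u \<in> V" "w \<in> V" "x \<in> V" "y \<in> V" "{u, w} \<inter> {x, y} = {}"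
    and ab: "\<exists>i. i \<in> above_set x u \<and> i \<in> above_set x w" "\<exists>i. i \<in> above_set y u \<and> i \<in> above_set y w"
      "\<exists>i. i \<in> above_set u x \<and> i \<in> above_set u y" "\<exists>i. i \<in> above_set w x \<and> i \<in> above_set w y"
  obtains c where "Re (heading u x / c) > 0" "Re (heading u y / c) > 0" "Re (heading w x / c) > 0" "Re (heading w y / c) > 0"
proof -
  have ne: "u \<noteq> x" "u \<noteq> y" "w \<noteq> x" "w \<noteq> y" using V(5) by auto
  have excl: "i \<notin> above_set b a" if "i \<in> above_set a b" "a \<in> V" "b \<in> V" "a \<noteq> b" for i a b
    using that above_linear[of i b a] by (auto simp: above_set_def)
  obtain i1 i2 i3 i4 where i: "i1 \<in> above_set x u" "i1 \<in> above_set x w" "i2 \<in> above_set y u" "i2 \<in> above_set y w"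
    "i3 \<in> above_set u x" "i3 \<in> above_set u y" "i4 \<in> above_set w x" "i4 \<in> above_set w y"
    using ab by blast
  have lt: "i1 < 3" "i2 < 3" "i3 < 3" "i4 < 3" using i by (auto simp: above_set_def)
  have "i1 \<noteq> i3" "i1 \<noteq> i4" "i2 \<noteq> i3" "i2 \<noteq> i4" using i excl V ne by metis+
  then consider "i1 = i2" | "i3 = i4" using lt by linarith
  then show thesis
  proof cases
    case 1
    have neg: "Re (heading a b / (- cube_root i1)) > 0" if "i1 \<in> above_set b a" "a \<in> V" "b \<in> V" "a \<noteq> b" for a b
      unfolding heading_def
      by (rule Re_direction_cube_root_neg) (use that above_set_proper excl lt in auto)
    show thesis by (rule that[of "- cube_root i1"]; rule neg) (use i 1 V ne in auto)
  next
    case 2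
    have pos: "Re (heading a b / cube_root i3) > 0" if "i3 \<in> above_set a b" "a \<in> V" "b \<in> V" "a \<noteq> b" for a b
      unfolding heading_def
      by (rule Re_direction_cube_root_pos) (use that above_set_proper in auto)
    show thesis by (rule that[of "cube_root i3"]; rule pos) (use i 2 V ne in auto)
  qed
qed

text \<open>The grid consists of pairs of vertices, one on each of two opposite paths. Each cell
  pairs two edges whose ends see the other edge with a common index, so its four headings share a
  half-plane and it has no net turn.\<close>

lemma turn_square:
  assumes ij: "i < 4" "j < 4" "i \<noteq> j" and kl: "k < 4" "l < 4" "k \<noteq> l" and disj: "{i, j} \<inter> {k, l} = {}"
  shows "turn i j k + turn k l j = turn i j l + turn k l i"
proof -
  define P Q where "P = oriented i j" and "Q = oriented k l"
  define H where "H = (\<lambda>a b. Arg (heading (P ! Suc a) (Q ! b) / heading (P ! a) (Q ! b)))"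
  define W where "W = (\<lambda>a b. Arg (heading (P ! a) (Q ! Suc b) / heading (P ! a) (Q ! b)))"
  note K = K4_edge[OF ij] K4_edge[OF kl]
  have "{i, j} \<noteq> {k, l}" using disj by auto
  then have xs_disj: "set (xs {i, j}) \<inter> set (xs {k, l}) = {}" using path_inter[OF K] disj by auto
  have "H a b + W (Suc a) b = H a (Suc b) + W a b" if a: "a < steps i j" and b: "b < steps k l" for a b
  proof -
    have mem: "P ! a \<in> set (xs {i, j})" "P ! Suc a \<in> set (xs {i, j})" "Q ! b \<in> set (xs {k, l})" "Q ! Suc b \<in> set (xs {k, l})"
      using oriented(3)[OF ij] oriented(3)[OF kl] a b by (auto simp: P_def Q_def)
    then have V: "P ! a \<in> V" "P ! Suc a \<in> V" "Q ! b \<in> V" "Q ! Suc b \<in> V"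
      using path(3)[OF K(1)] path(3)[OF K(2)] by auto
    have ne: "{P ! a, P ! Suc a} \<inter> {Q ! b, Q ! Suc b} = {}" using mem xs_disj by auto
    obtain d where d: "d \<in> set (es {i, j})" "ends (graph M) d = {P ! a, P ! Suc a}"
      using oriented(4)[OF ij a] by (auto simp: P_def)
    obtain d' where d': "d' \<in> set (es {k, l})" "ends (graph M) d' = {Q ! b, Q ! Suc b}"
      using oriented(4)[OF kl b] by (auto simp: Q_def)
    have disj': "{k, l} \<inter> {i, j} = {}" using disj by blast
    have 1: "\<exists>n. n \<in> above_set v (P ! a) \<and> n \<in> above_set v (P ! Suc a)" if "v \<in> set (xs {k, l})" for v
      using opposite_edge_below[OF K disj d that] by blast
    have 2: "\<exists>n. n \<in> above_set v (Q ! b) \<and> n \<in> above_set v (Q ! Suc b)" if "v \<in> set (xs {i, j})" for v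
      using opposite_edge_below[OF K(2,1) disj' d' that] by blast
    obtain c where c: "Re (heading (P ! a) (Q ! b) / c) > 0" "Re (heading (P ! a) (Q ! Suc b) / c) > 0"
      "Re (heading (P ! Suc a) (Q ! b) / c) > 0" "Re (heading (P ! Suc a) (Q ! Suc b) / c) > 0"
      using common_half_plane[OF V ne 1[OF mem(3)] 1[OF mem(4)] 2[OF mem(1)] 2[OF mem(2)]] .
    show ?thesis
      unfolding H_def W_def
      using Arg_divide_half_plane[OF c(1,3)] Arg_divide_half_plane[OF c(3,4)]
        Arg_divide_half_plane[OF c(2,4)] Arg_divide_half_plane[OF c(1,2)] by simp
  qed
  then have "(\<Sum>a<steps i j. H a 0) + (\<Sum>b<steps k l. W (steps i j) b) =
      (\<Sum>a<steps i j. H a (steps k l)) + (\<Sum>b<steps k l. W 0 b)"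
    by (rule grid_boundary_sum)
  moreover have "turn i j k = (\<Sum>a<steps i j. H a 0)" "turn i j l = (\<Sum>a<steps i j. H a (steps k l))"
    using oriented(1,2)[OF kl] by (simp_all add: turn_def H_def P_def Q_def)
  \<comment> \<open>In \<open>W\<close> the moving vertex is the second argument of
    \<open>heading\<close>, so \<open>turn_swap\<close> intervenes.\<close>
  moreover have "turn k l j = (\<Sum>b<steps k l. W (steps i j) b)" "turn k l i = (\<Sum>b<steps k l. W 0 b)"
    using turn_swap[OF kl ij(1)] turn_swap[OF kl ij(2)] oriented(1,2)[OF ij] disj
    by (auto simp: W_def P_def Q_def)
  ultimately show ?thesis by simp
qed

lemma no_K4_in_map: False
proof (rule no_turning_system_on_K4[of "\<lambda>i j. heading (f i) (f j)" turn])
  fix i j :: nat assume ij: "i < j" "j < 4"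
  then have "f i \<noteq> f j" "f i \<in> V" "f j \<in> V" using f_eq[of i j] f_in_V by auto
  then show "norm (heading (f i) (f j)) = 1" "heading (f j) (f i) = - heading (f i) (f j)"
    using norm_heading heading_swap by blast+
  show "cis (turn i j k) = heading (f j) (f k) / heading (f i) (f k)" if "k < 4" "k \<noteq> i" "k \<noteq> j" for k
    using cis_turn ij that by simp
  show "turn i j k + turn k l j = turn i j l + turn k l i" if "k < l" "l < 4" "{i, j} \<inter> {k, l} = {}" for k l
    using turn_square[of i j k l] ij that by simp
qed (rule turn_triangle)

end

section \<open>Passing from realizers and subdivisions to three orders and six paths\<close>

lemma finite_nonempty_enum:
  assumes "finite R" "R \<noteq> {}" "card R \<le> n"
  obtains L :: "nat \<Rightarrow> 'a" where "L ` {..<n} = R"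
proof -
  obtain h where h: "bij_betw h {0..<card R} R" using ex_bij_betw_nat_finite[OF assms(1)] by blast
  have pos: "0 < card R" using assms by (simp add: card_gt_0_iff)
  \<comment> \<open>A set with fewer than \<open>n\<close> elements is padded by repeating
    \<open>h 0\<close>.\<close>
  define L where "L = (\<lambda>i. h (if i < card R then i else 0))"
  have "L ` {..<n} = h ` {0..<card R}"
  proof
    show "L ` {..<n} \<subseteq> h ` {0..<card R}" using pos by (auto simp: L_def)
    show "h ` {0..<card R} \<subseteq> L ` {..<n}"
    proof
      fix y assume "y \<in> h ` {0..<card R}"
      then obtain i where "i < card R" "y = h i" by auto
      then show "y \<in> L ` {..<n}" using assms(3) by (intro image_eqI[of _ _ i]) (auto simp: L_def)
    qed
  qed
  then show thesis using that h by (simp add: bij_betw_def)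
qed

lemma vf_poset_carrier: "fst (vf_poset M) = Vertex ` vertices (graph M) \<union> Face ` faces M"
  by (auto simp: vf_poset_def subposet_def vef_poset_def Let_def)

lemma vf_poset_vertices: "(Vertex v, Vertex w) \<in> snd (vf_poset M) \<longleftrightarrow> v = w \<and> v \<in> vertices (graph M)"
  by (auto simp: vf_poset_def subposet_def vef_poset_def Let_def)

lemma vf_poset_vertex_face:
  "(Vertex v, Face F) \<in> snd (vf_poset M) \<longleftrightarrow> v \<in> vertices (graph M) \<and> F \<in> faces M \<and> point M v \<in> frontier F"
  by (auto simp: vf_poset_def subposet_def vef_poset_def Let_def)

text \<open>If a vertex is not on a face, some order puts the face below the vertex, and by
  transitivity all vertices of the face too. The inequality in the relation makes it strict.\<close>

lemma three_orders_of_realizer: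
  fixes M :: "('v, 'e) planar_map"
  assumes "planar_map M" and R: "realizer (vf_poset M) R" and L: "L ` {..<3} = R"
  shows "three_orders M (\<lambda>i v w. (Vertex w, Vertex v) \<in> L i \<and> w \<noteq> v)"
proof -
  let ?A = "fst (vf_poset M)"
  have lin: "total_on ?A (L i)" "antisym (L i)" "trans (L i)" "snd (vf_poset M) \<subseteq> L i" if "i < 3" for i
  proof -
    have "L i \<in> R" using that L by auto
    then show "total_on ?A (L i)" "antisym (L i)" "trans (L i)" "snd (vf_poset M) \<subseteq> L i"
      using R by (auto simp: realizer_def linear_order_on_def partial_order_on_def preorder_on_def)
  qed
  \<comment> \<open>A pair outside the intersection is missing from some order, and totality
    supplies the reversed pair there.\<close>
  have rev: "\<exists>i<3. (b, a) \<in> L i" if "a \<in> ?A" "b \<in> ?A" "a \<noteq> b" "(a, b) \<notin> snd (vf_poset M)" for a b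
  proof -
    have "(a, b) \<notin> \<Inter> R" using R that(4) by (simp add: realizer_def)
    then obtain i where "i < 3" "(a, b) \<notin> L i" using L by blast
    then show ?thesis using lin(1) that by (auto simp: total_on_def)
  qed
  show ?thesis
  proof
    show "planar_map M" by fact
  next
    fix i v w assume i: "i < (3::nat)" and vw: "v \<in> vertices (graph M)" "w \<in> vertices (graph M)" "v \<noteq> w"
    then have "Vertex v \<in> ?A" "Vertex w \<in> ?A" "Vertex v \<noteq> Vertex w" by (simp_all add: vf_poset_carrier)
    then have "(Vertex v, Vertex w) \<in> L i \<or> (Vertex w, Vertex v) \<in> L i"
      "\<not> ((Vertex v, Vertex w) \<in> L i \<and> (Vertex w, Vertex v) \<in> L i)"
      using lin(1,2)[OF i] by (metis total_on_def, metis antisymD)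
    then show "((Vertex v, Vertex w) \<in> L i \<and> v \<noteq> w) = (\<not> ((Vertex w, Vertex v) \<in> L i \<and> w \<noteq> v))"
      using vw(3) by blast
  next
    fix v w assume "v \<in> vertices (graph M)" "w \<in> vertices (graph M)" "v \<noteq> w"
    then show "\<exists>i<3. (Vertex w, Vertex v) \<in> L i \<and> w \<noteq> v"
      using rev[of "Vertex v" "Vertex w"] by (auto simp: vf_poset_carrier vf_poset_vertices)
  next
    fix v F assume v: "v \<in> vertices (graph M)" and F: "F \<in> faces M" "point M v \<notin> frontier F"
    then obtain i where i: "i < 3" "(Face F, Vertex v) \<in> L i"
      using rev[of "Vertex v" "Face F"] by (auto simp: vf_poset_carrier vf_poset_vertex_face)
    have "(Vertex u, Vertex v) \<in> L i" if "u \<in> vertices (graph M)" "point M u \<in> frontier F" for u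
    proof -
      have "(Vertex u, Face F) \<in> snd (vf_poset M)" using that F(1) by (simp add: vf_poset_vertex_face)
      then have "(Vertex u, Face F) \<in> L i" by (rule subsetD[OF lin(4)[OF i(1)]])
      then show ?thesis using lin(3)[OF i(1)] i(2) by (meson transD)
    qed
    then show "\<exists>i<3. \<forall>u\<in>vertices (graph M). point M u \<in> frontier F \<longrightarrow> (Vertex u, Vertex v) \<in> L i \<and> u \<noteq> v"
      using i(1) F(2) by blast
  qed
qed

text \<open>\<open>graph_path\<close> admits closed paths; distinct ends exclude the one repetition
  that its conditions leave open.\<close>

lemma distinct_path:
  assumes "distinct (tl ys)" "distinct (butlast ys)" "hd ys \<noteq> last ys"
  shows "distinct ys"
proof (cases ys)
  case (Cons y zs)
  then have "zs \<noteq> []" using assms(3) by auto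
  then have "zs = butlast zs @ [last zs]" "butlast ys = y # butlast zs" "last ys = last zs" using Cons by auto
  then have "y \<notin> set zs" using assms Cons by (metis Un_iff distinct.simps(2) empty_iff empty_set list.sel(1) set_ConsD set_append)
  then show ?thesis using Cons assms(1) by simp
qed simp

lemma set_path:
  assumes "length ys = Suc n" "n \<noteq> 0"
  shows "set ys = {hd ys, last ys} \<union> inner_vertices ys"
proof -
  obtain y zs where ys: "ys = y # zs" "zs \<noteq> []" using assms by (metis Suc_length_conv length_0_conv)
  then have "set zs = insert (last zs) (set (butlast zs))"
    by (metis append_butlast_last_id list.set(1,2) set_append Un_insert_right sup_bot_right)
  then show ?thesis using ys by (auto simp: inner_vertices_def)
qed

lemma K4_in_map_of_subdivision:
  fixes M :: "('v, 'e) planar_map" and above :: "nat \<Rightarrow> 'v \<Rightarrow> 'v \<Rightarrow> bool"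
  assumes "three_orders M above" and "contains_subdivision_of (graph M) (complete_graph 4)"
  shows "\<exists>f xs es. K4_in_map M above f xs es"
proof -
  interpret three_orders M above by fact
  obtain H where H: "subgraph H (graph M)" "subdivision (complete_graph 4) H"
    using assms(2) by (auto simp: contains_subdivision_of_def)
  have K: "vertices (complete_graph 4) = {..<4}" "edges (complete_graph 4) = K4_edges" "ends (complete_graph 4) = (\<lambda>e. e)"
    by (simp_all add: complete_graph_def K4_edges_def)
  obtain f :: "nat \<Rightarrow> 'v" and xs :: "nat set \<Rightarrow> 'v list" and es :: "nat set \<Rightarrow> 'e list" where
    inj: "inj_on f {..<4}"
    and path: "\<forall>e\<in>K4_edges. graph_path H (xs e) (es e) \<and> {hd (xs e), last (xs e)} = f ` e \<and> inner_vertices (xs e) \<inter> f ` {..<4} = {}"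
    and disj: "\<forall>e\<in>K4_edges. \<forall>e'\<in>K4_edges. e \<noteq> e' \<longrightarrow> inner_vertices (xs e) \<inter> inner_vertices (xs e') = {} \<and> set (es e) \<inter> set (es e') = {}"
    and VH: "vertices H = f ` {..<4} \<union> (\<Union>e\<in>K4_edges. set (xs e))"
    using H(2) unfolding subdivision_def K by (elim exE conjE) (rule that)
  have sub: "vertices H \<subseteq> V" "edges H \<subseteq> E" "\<And>e. e \<in> edges H \<Longrightarrow> ends H e = ends (graph M) e"
    using H(1) by (auto simp: subgraph_def)
  have p: "es e \<noteq> []" "length (xs e) = Suc (length (es e))" "set (xs e) \<subseteq> vertices H" "set (es e) \<subseteq> edges H"
      "\<forall>i<length (es e). ends H (es e ! i) = {xs e ! i, xs e ! Suc i}"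
      "distinct (tl (xs e))" "distinct (butlast (xs e))"
      "{hd (xs e), last (xs e)} = f ` e" "inner_vertices (xs e) \<inter> f ` {..<4} = {}" if "e \<in> K4_edges" for e
    using path that by (auto simp: graph_path_def)
  have sub4: "e \<subseteq> {..<4}" if "e \<in> K4_edges" for e using that by (simp add: K4_edges_def)
  have set_xs: "set (xs e) = f ` e \<union> inner_vertices (xs e)" if "e \<in> K4_edges" for e
    using set_path[OF p(2)[OF that]] p(1,8)[OF that] by simp
  have "K4_in_map M above f xs es"
  proof unfold_locales
    show "inj_on f {..<4}" by fact
    show "f ` {..<4} \<subseteq> V" using VH sub(1) by blast
  next
    fix e assume e: "e \<in> K4_edges"
    note q = p[OF e]
    show "es e \<noteq> []" "length (xs e) = Suc (length (es e))" "{hd (xs e), last (xs e)} = f ` e" using q by blast+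
    show "set (xs e) \<subseteq> V" "set (es e) \<subseteq> E" using q(3,4) sub by blast+
    show "\<forall>i<length (es e). ends (graph M) (es e ! i) = {xs e ! i, xs e ! Suc i}"
    proof (intro allI impI)
      fix i assume i: "i < length (es e)"
      then have "es e ! i \<in> edges H" using q(4) by auto
      then show "ends (graph M) (es e ! i) = {xs e ! i, xs e ! Suc i}" using q(5) i sub(3) by metis
    qed
    \<comment> \<open>As \<open>f\<close> is injective, the two ends of the path differ, so it is
      not closed.\<close>
    have "card (f ` e) = 2"
      using card_image[OF inj_on_subset[OF inj sub4[OF e]]] e by (simp add: K4_edges_def)
    then have "hd (xs e) \<noteq> last (xs e)" using q(8)[symmetric] by auto
    then show "distinct (xs e)" using distinct_path q(6,7) by blast
    show "set (xs e) \<inter> f ` {..<4} \<subseteq> f ` e" using set_xs[OF e] q(9) by blast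
  next
    fix e e' assume e: "e \<in> K4_edges" "e' \<in> K4_edges" "e \<noteq> e'"
    show "set (es e) \<inter> set (es e') = {}" using disj e by blast
    have "f ` e \<inter> f ` e' = f ` (e \<inter> e')"
      using inj_on_image_Int[OF inj sub4[OF e(1)] sub4[OF e(2)]] by simp
    moreover have "f ` e \<subseteq> f ` {..<4}" "f ` e' \<subseteq> f ` {..<4}" using sub4 e by (simp_all add: image_mono)
    moreover have "inner_vertices (xs e) \<inter> inner_vertices (xs e') = {}" using disj e by simp
    moreover note p(9)[OF e(1)] p(9)[OF e(2)]
    ultimately have "v \<in> f ` (e \<inter> e')" if "v \<in> f ` e \<union> inner_vertices (xs e)" "v \<in> f ` e' \<union> inner_vertices (xs e')" for v
      using that by (metis IntI UnE empty_iff subsetD)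
    then show "set (xs e) \<inter> set (xs e') \<subseteq> f ` (e \<inter> e')"
      unfolding set_xs[OF e(1)] set_xs[OF e(2)] by (meson IntE subsetI)
  qed
  then show ?thesis by blast
qed

theorem theorem2p1:
  fixes M :: "('v, 'e) planar_map"
  assumes "planar_map M"
    and "contains_subdivision_of (graph M) (complete_graph 4)"
  shows "poset_dim (vf_poset M) > 3"
proof -
  have "4 \<le> enat (card R)" if R: "finite R" "realizer (vf_poset M) R" for R
  proof (rule ccontr)
    assume "\<not> 4 \<le> enat (card R)"
    then have "card R \<le> 3" by (simp add: numeral_eq_enat)
    moreover have "R \<noteq> {}" using R(2) by (simp add: realizer_def)
    ultimately obtain L :: "nat \<Rightarrow> ('v, 'e) cell rel" where L: "L ` {..<3} = R"
      using finite_nonempty_enum[OF R(1)] by blast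
    obtain f xs es where "K4_in_map M (\<lambda>i v w. (Vertex w, Vertex v) \<in> L i \<and> w \<noteq> v) f xs es"
      using K4_in_map_of_subdivision[OF three_orders_of_realizer[OF assms(1) R(2) L] assms(2)] by blast
    then show False by (rule K4_in_map.no_K4_in_map)
  qed
  \<comment> \<open>The dimension is an infimum over finite realizers, so a lower bound for each of
    them suffices.\<close>
  then have "4 \<le> poset_dim (vf_poset M)"
    unfolding poset_dim_def by (intro INF_greatest) auto
  moreover have "(3::enat) < 4" by simp
  ultimately show ?thesis by (rule less_le_trans[rotated])
qed

end
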